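(* Let $\gamma>0$ and $\rho>0$ be fixed. As $\lambda\to0+$ the following limits hold: $$\varphi_{\rho,+}^{0,0}\longrightarrow0\quad\text{in the weak topology of }Q_{\delta'},$$ $$\varphi_{\rho,+}^{x_{1\pm},x_{2\pm}}\longrightarrow0\quad\text{in the weak topology of }Q_{\delta'}\ \text{(for both choices of the sign }\pm),$$ $$\varphi_{\rho,-}^{\bar x,-\bar x}\longrightarrow\operatorname{sgn}(\cdot)\,\sqrt{\frac{2\rho}\gamma}\,e^{-\frac2\gamma|\cdot|}\quad\text{in the strong topology of }Q_{\delta'}.$$
   Context: $Q_{\delta'}=H^1(\mathbb R^+)\oplus H^1(\mathbb R^-)$ with its natural Hilbert norm. For $\lambda,\gamma,\omega>0$ define the following functions (stationary states of the focusing cubic NLS with nonlinearity coefficient $\lambda$ and a delta prime interaction of strength $\gamma$). (i) $\psi_{\omega,+}^{0,0}(x)=\sqrt{2\omega/\lambda}\,\operatorname{sech}(\sqrt\omega x)$, $\omega>0$. (ii) For $\omega>0$, $\psi_{\omega,+}^{x_{1\pm},x_{2\pm}}(x)=\sqrt{2\omega/\lambda}\,\operatorname{sech}(\sqrt\omega(x-x_{1\pm}))$ for $x<0$ and $\sqrt{2\omega/\lambda}\,\operatorname{sech}(\sqrt\omega(x-x_{2\pm}))$ for $x>0$, where $x_{i+}=\frac1{2\sqrt\omega}\log\frac{1+t_i}{1-t_i}$ ($i=1,2$), $x_{1-}=-x_{2+}$, $x_{2-}=-x_{1+}$, and $$t_1=\frac{1-\sqrt{1+\gamma^2\omega}+\sqrt{\gamma^2\omega-2+2\sqrt{1+\gamma^2\omega}}}{2\gamma\sqrt\omega},\quad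 t_2=\frac{-1+\sqrt{1+\gamma^2\omega}+\sqrt{\gamma^2\omega-2+2\sqrt{1+\gamma^2\omega}}}{2\gamma\sqrt\omega}.$$ (iii) For $\omega>4/\gamma^2$, $\psi_{\omega,-}^{\bar x,-\bar x}(x)=-\sqrt{2\omega/\lambda}\,\operatorname{sech}(\sqrt\omega(x-\bar x))$ for $x<0$ and $\sqrt{2\omega/\lambda}\,\operatorname{sech}(\sqrt\omega(x+\bar x))$ for $x>0$, with $\bar x=\frac1{2\sqrt\omega}\log\frac{\gamma\sqrt\omega+2}{\gamma\sqrt\omega-2}$. In each family the squared $L^2$-norm is a strictly increasing function of $\omega$ with range $(0,+\infty)$; for $\rho>0$, $\varphi_{\rho,+}^{0,0}$, $\varphi_{\rho,+}^{x_{1\pm},x_{2\pm}}$, $\varphi_{\rho,-}^{\bar x,-\bar x}$ denote the member of the corresponding family ($\gamma,\lambda$ given) whose squared $L^2$-norm equals $\rho$. *)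

theory Defs
  imports "HOL-Analysis.Analysis"
begin

section \<open>The energy space\<close>

text \<open>
  Elements of \<open>L\<^sup>2\<close> and \<open>H\<^sup>1\<close> are represented by Borel functions rather than by classes
  modulo a.e. equality. All functionals and topologies below respect a.e. equality on the
  relevant set, so the topologies are the pullbacks of those on the spaces of classes.
\<close>

definition L2_space :: "real set \<Rightarrow> (real \<Rightarrow> complex) set" where
  "L2_space A = {u. set_borel_measurable lborel A u \<and>
                    set_integrable lborel A (\<lambda>x. (cmod (u x))\<^sup>2)}"

definition L2_norm_sq :: "real set \<Rightarrow> (real \<Rightarrow> complex) \<Rightarrow> real" where
  "L2_norm_sq A u = (LINT x:A|lborel. (cmod (u x))\<^sup>2)"

definition test_functions :: "real set \<Rightarrow> (real \<Rightarrow> real) set" where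
  "test_functions A = {\<phi>. (\<forall>n x. (deriv ^^ n) \<phi> field_differentiable at x) \<and>
                          (\<exists>K. compact K \<and> K \<subseteq> A \<and> (\<forall>x. x \<notin> K \<longrightarrow> \<phi> x = 0))}"

definition is_weak_deriv :: "real set \<Rightarrow> (real \<Rightarrow> complex) \<Rightarrow> (real \<Rightarrow> complex) \<Rightarrow> bool" where
  "is_weak_deriv A u v \<longleftrightarrow>
     (\<forall>\<phi>\<in>test_functions A.
        (LINT x:A|lborel. u x * of_real (deriv \<phi> x)) = - (LINT x:A|lborel. v x * of_real (\<phi> x)))"

definition H1_space :: "real set \<Rightarrow> (real \<Rightarrow> complex) set" where
  "H1_space A = {u \<in> L2_space A. \<exists>v\<in>L2_space A. is_weak_deriv A u v}"

text \<open>For open \<open>A\<close> the weak derivative is unique up to a null set of \<open>A\<close>.\<close>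

definition weak_deriv :: "real set \<Rightarrow> (real \<Rightarrow> complex) \<Rightarrow> (real \<Rightarrow> complex)" where
  "weak_deriv A u = (SOME v. v \<in> L2_space A \<and> is_weak_deriv A u v)"

definition H1_norm_sq :: "real set \<Rightarrow> (real \<Rightarrow> complex) \<Rightarrow> real" where
  "H1_norm_sq A u = L2_norm_sq A u + L2_norm_sq A (weak_deriv A u)"

text \<open>
  An element of \<open>H\<^sup>1(\<real>\<^sup>+) \<oplus> H\<^sup>1(\<real>\<^sup>-)\<close> is given as one function on the line,
  whose value at \<open>0\<close> is irrelevant and which may jump there.
\<close>

definition Q_space :: "(real \<Rightarrow> complex) set" where
  "Q_space = {u. u \<in> H1_space {0<..} \<and> u \<in> H1_space {..<0}}"

definition Q_norm :: "(real \<Rightarrow> complex) \<Rightarrow> real" where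
  "Q_norm u = sqrt (H1_norm_sq {0<..} u + H1_norm_sq {..<0} u)"

definition Q_dual :: "((real \<Rightarrow> complex) \<Rightarrow> complex) set" where
  "Q_dual = {F. (\<forall>u\<in>Q_space. \<forall>v\<in>Q_space. \<forall>a b.
                   F (\<lambda>x. a * u x + b * v x) = a * F u + b * F v) \<and>
                (\<exists>C. \<forall>u\<in>Q_space. cmod (F u) \<le> C * Q_norm u)}"

definition Q_weak_topology :: "(real \<Rightarrow> complex) topology" where
  "Q_weak_topology =
     topology_generated_by {{u \<in> Q_space. F u \<in> U} | F U. F \<in> Q_dual \<and> open U}"

definition Q_strong_topology :: "(real \<Rightarrow> complex) topology" where
  "Q_strong_topology =
     topology (\<lambda>U. U \<subseteq> Q_space \<and>
       (\<forall>u\<in>U. \<exists>e>0. \<forall>v\<in>Q_space. Q_norm (\<lambda>x. v x - u x) < e \<longrightarrow> v \<in> U))"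

lemma openin_Q_strong_topology:
  "openin Q_strong_topology U \<longleftrightarrow>
     U \<subseteq> Q_space \<and> (\<forall>u\<in>U. \<exists>e>0. \<forall>v\<in>Q_space. Q_norm (\<lambda>x. v x - u x) < e \<longrightarrow> v \<in> U)"
proof -
  let ?P = "\<lambda>U. U \<subseteq> Q_space \<and>
       (\<forall>u\<in>U. \<exists>e>0. \<forall>v\<in>Q_space. Q_norm (\<lambda>x. v x - u x) < e \<longrightarrow> v \<in> U)"
  have "?P (S \<inter> T)" if S: "?P S" and T: "?P T" for S T
  proof (intro conjI ballI)
    show "S \<inter> T \<subseteq> Q_space" using S by blast
    fix u assume u: "u \<in> S \<inter> T"
    obtain d where d: "d > 0" "\<forall>v\<in>Q_space. Q_norm (\<lambda>x. v x - u x) < d \<longrightarrow> v \<in> S"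
      using S u by blast
    obtain e where e: "e > 0" "\<forall>v\<in>Q_space. Q_norm (\<lambda>x. v x - u x) < e \<longrightarrow> v \<in> T"
      using T u by blast
    show "\<exists>e>0. \<forall>v\<in>Q_space. Q_norm (\<lambda>x. v x - u x) < e \<longrightarrow> v \<in> S \<inter> T"
      using d e by (intro exI[of _ "min d e"]) auto
  qed
  moreover have "?P (\<Union>\<K>)" if "\<forall>K\<in>\<K>. ?P K" for \<K>
    using that by (meson Union_iff Sup_least)
  ultimately have "istopology ?P"
    unfolding istopology_def by blast
  then show ?thesis
    by (simp add: Q_strong_topology_def)
qed


section \<open>Stationary states\<close>

definition sech :: "real \<Rightarrow> real" where
  "sech x = 1 / cosh x"

text \<open>
  In the following \<open>l\<close> is the coefficient of the nonlinearity, \<open>\<gamma>\<close> the strength of the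
  delta prime interaction and \<open>\<omega>\<close> the frequency.
\<close>

definition psi_even :: "real \<Rightarrow> real \<Rightarrow> real \<Rightarrow> complex" where
  "psi_even l \<omega> x = of_real (sqrt (2 * \<omega> / l) * sech (sqrt \<omega> * x))"

definition t1 :: "real \<Rightarrow> real \<Rightarrow> real" where
  "t1 \<gamma> \<omega> = (1 - sqrt (1 + \<gamma>\<^sup>2 * \<omega>) + sqrt (\<gamma>\<^sup>2 * \<omega> - 2 + 2 * sqrt (1 + \<gamma>\<^sup>2 * \<omega>)))
             / (2 * \<gamma> * sqrt \<omega>)"

definition t2 :: "real \<Rightarrow> real \<Rightarrow> real" where
  "t2 \<gamma> \<omega> = (- 1 + sqrt (1 + \<gamma>\<^sup>2 * \<omega>) + sqrt (\<gamma>\<^sup>2 * \<omega> - 2 + 2 * sqrt (1 + \<gamma>\<^sup>2 * \<omega>)))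
             / (2 * \<gamma> * sqrt \<omega>)"

definition shift_of :: "real \<Rightarrow> real \<Rightarrow> real" where
  "shift_of \<omega> t = 1 / (2 * sqrt \<omega>) * ln ((1 + t) / (1 - t))"

datatype sign = Plus | Minus

fun x1 :: "sign \<Rightarrow> real \<Rightarrow> real \<Rightarrow> real" where
  "x1 Plus \<gamma> \<omega> = shift_of \<omega> (t1 \<gamma> \<omega>)"
| "x1 Minus \<gamma> \<omega> = - shift_of \<omega> (t2 \<gamma> \<omega>)"

fun x2 :: "sign \<Rightarrow> real \<Rightarrow> real \<Rightarrow> real" where
  "x2 Plus \<gamma> \<omega> = shift_of \<omega> (t2 \<gamma> \<omega>)"
| "x2 Minus \<gamma> \<omega> = - shift_of \<omega> (t1 \<gamma> \<omega>)"

text \<open>The value at \<open>x = 0\<close> is immaterial here and in the next family.\<close>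

definition psi_asym :: "sign \<Rightarrow> real \<Rightarrow> real \<Rightarrow> real \<Rightarrow> real \<Rightarrow> complex" where
  "psi_asym s \<gamma> l \<omega> x =
     (if x < 0 then of_real (sqrt (2 * \<omega> / l) * sech (sqrt \<omega> * (x - x1 s \<gamma> \<omega>)))
      else of_real (sqrt (2 * \<omega> / l) * sech (sqrt \<omega> * (x - x2 s \<gamma> \<omega>))))"

definition xbar :: "real \<Rightarrow> real \<Rightarrow> real" where
  "xbar \<gamma> \<omega> = 1 / (2 * sqrt \<omega>) * ln ((\<gamma> * sqrt \<omega> + 2) / (\<gamma> * sqrt \<omega> - 2))"

definition psi_odd :: "real \<Rightarrow> real \<Rightarrow> real \<Rightarrow> real \<Rightarrow> complex" where
  "psi_odd \<gamma> l \<omega> x =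
     (if x < 0 then of_real (- sqrt (2 * \<omega> / l) * sech (sqrt \<omega> * (x - xbar \<gamma> \<omega>)))
      else of_real (sqrt (2 * \<omega> / l) * sech (sqrt \<omega> * (x + xbar \<gamma> \<omega>))))"

text \<open>
  The member of a family \<open>psi\<close>, indexed by frequencies in \<open>I\<close>, with squared \<open>L\<^sup>2\<close> norm \<open>\<rho>\<close>.
  The frequency is unique for the three families because this norm is strictly increasing in
  \<open>\<omega>\<close> with range \<open>(0, \<infinity>)\<close>.
\<close>

definition member_of_mass ::
    "real set \<Rightarrow> (real \<Rightarrow> real \<Rightarrow> complex) \<Rightarrow> real \<Rightarrow> real \<Rightarrow> complex" where
  "member_of_mass I psi \<rho> = psi (THE \<omega>. \<omega> \<in> I \<and> L2_norm_sq UNIV (psi \<omega>) = \<rho>)"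

definition phi_even :: "real \<Rightarrow> real \<Rightarrow> real \<Rightarrow> complex" where
  "phi_even l \<rho> = member_of_mass {0<..} (psi_even l) \<rho>"

definition phi_asym :: "sign \<Rightarrow> real \<Rightarrow> real \<Rightarrow> real \<Rightarrow> real \<Rightarrow> complex" where
  "phi_asym s \<gamma> l \<rho> = member_of_mass {0<..} (psi_asym s \<gamma> l) \<rho>"

definition phi_odd :: "real \<Rightarrow> real \<Rightarrow> real \<Rightarrow> real \<Rightarrow> complex" where
  "phi_odd \<gamma> l \<rho> = member_of_mass {4 / \<gamma>\<^sup>2<..} (psi_odd \<gamma> l) \<rho>"

end

theory Submission
  imports Defs
begin

text \<open>
  Every stationary state is a translated soliton \<open>A sech (k (x - p))\<close> on each half line, with
  \<open>k = sqrt \<omega>\<close> and \<open>A = k sqrt (2 / l)\<close>. Since \<open>tanh\<close> is an antiderivative of \<open>sech\<^sup>2\<close> and the shifts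
  are inverse hyperbolic tangents, the masses are explicit:

  \<^item> \<open>4 k / l\<close> for the even family,
  \<^item> \<open>2 / l (2 k + (sqrt (1 + \<gamma>\<^sup>2 k\<^sup>2) - 1) / \<gamma>)\<close> for the asymmetric family, for both signs,
  \<^item> \<open>4 / l (k - 2 / \<gamma>)\<close> for the odd family.

  Fix the mass \<open>\<rho>\<close> and let \<open>l\<close> tend to \<open>0\<close>. In the first two families \<open>k \<le> l \<rho> / 4\<close>, so the
  amplitude \<open>A\<close> is of order \<open>sqrt l\<close>: the profiles flatten out while their mass stays equal to
  \<open>\<rho>\<close>. Weak convergence to zero (lemma \<open>Q_dual_tendsto_0\<close>) comes from asymptotic orthogonality: the
  overlap of a fixed profile with a later one is at most the integral of the first times the height
  of the second. If a functional \<open>\<Phi>\<close> stayed away from zero along the family, one could add \<open>N\<close>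
  almost orthogonal profiles, with phases making all values of \<open>\<Phi>\<close> positive; the sum would
  have norm of order \<open>sqrt N\<close> but a value of \<open>\<Phi>\<close> of order \<open>N\<close>, contradicting boundedness.

  In the third family \<open>k = 2 / \<gamma> + l \<rho> / 4\<close> tends to \<open>2 / \<gamma>\<close> while the shift escapes to infinity, so that
  only the exponential tail of the soliton remains. Written as
  \<open>a exp (- k x) / (1 + r exp (- 2 k x))\<close> on the right half line, the profile has coefficients
  \<open>a\<close> and \<open>r\<close> that converge to \<open>sqrt (2 \<rho> / \<gamma>)\<close> and \<open>0\<close>, and dominated convergence applies to the profile and to
  its derivative.

  The norm of \<open>Q_space\<close> is defined by means of an arbitrary weak derivative. To compute it, one needs that
  weak derivatives are unique up to null sets (lemma \<open>weak_deriv_unique\<close>), which is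
  the fundamental lemma of the calculus of variations; its proof takes explicit smooth bump
  functions as test functions.
\<close>

section \<open>Smooth bump functions\<close>

text \<open>
  The case \<open>p = 1\<close> is the classical smooth function that vanishes to infinite order at \<open>0\<close>. The
  polynomial factor makes the class closed under differentiation, and the scale \<open>c\<close> will
  tend to \<open>0\<close>, where the function becomes a step.
\<close>

definition flat :: "real \<Rightarrow> real poly \<Rightarrow> real \<Rightarrow> real" where
  "flat c p x = (if 0 < x then poly p (1 / x) * exp (- c / x) else 0)"

lemma poly_times_exp_neg_tendsto_0:
  fixes p :: "real poly"
  assumes "0 < c"
  shows "((\<lambda>y. poly p y * exp (- c * y)) \<longlongrightarrow> 0) at_top"
proof -
  have power: "((\<lambda>y. y ^ n * exp (- c * y)) \<longlongrightarrow> 0) at_top" for n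
  proof -
    have "filterlim (\<lambda>y. c * y) at_top at_top"
      using assms by (intro filterlim_tendsto_pos_mult_at_top[OF tendsto_const]) (auto simp: filterlim_ident)
    from filterlim_compose[OF tendsto_power_div_exp_0 this, of n]
    have "((\<lambda>y. (c * y) ^ n / exp (c * y) / c ^ n) \<longlongrightarrow> 0 / c ^ n) at_top"
      using assms by (intro tendsto_intros) auto
    then show ?thesis
      using assms by (simp add: power_mult_distrib exp_minus field_simps)
  qed
  have "((\<lambda>y. \<Sum>i\<le>degree p. coeff p i * (y ^ i * exp (- c * y))) \<longlongrightarrow> (\<Sum>i\<le>degree p. coeff p i * 0)) at_top"
    by (intro tendsto_intros power)
  then show ?thesis
    by (simp add: poly_altdef sum_distrib_right mult.assoc)
qed

lemma flat_has_derivative: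
  assumes "0 < c"
  shows "(flat c p has_real_derivative flat c (monom 1 2 * (smult c p - pderiv p)) x) (at x)"
proof -
  consider "x > 0" | "x < 0" | "x = 0" by linarith
  then show ?thesis
  proof cases
    case 1
    have "((\<lambda>x. poly p (1 / x) * exp (- c / x)) has_real_derivative
            flat c (monom 1 2 * (smult c p - pderiv p)) x) (at x)"
      using 1
      by (auto intro!: derivative_eq_intros DERIV_chain2[OF poly_DERIV]
          simp: flat_def poly_monom power2_eq_square field_simps)
    moreover have "\<forall>\<^sub>F y in nhds x. flat c p y = poly p (1 / y) * exp (- c / y)"
      using eventually_nhds_in_open[of "{0<..}" x] 1
      by (auto simp: flat_def elim!: eventually_mono)
    ultimately show ?thesis
      by (subst DERIV_cong_ev) auto
  next
    case 2
    have "\<forall>\<^sub>F y in nhds x. flat c p y = 0"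
      using eventually_nhds_in_open[of "{..<0}" x] 2
      by (auto simp: flat_def elim!: eventually_mono)
    then show ?thesis
      using 2 by (subst DERIV_cong_ev[of _ x _ "\<lambda>_. 0" _ 0]) (auto simp: flat_def)
  next
    case 3
    \<comment> \<open>Dividing by \<open>x\<close> in the difference quotient raises the degree of the polynomial in \<open>1 / x\<close> by one.\<close>
    have "((\<lambda>x. poly (pCons 0 p) (1 / x) * exp (- c * (1 / x))) \<longlongrightarrow> 0) (at_right 0)"
      using filterlim_compose[OF poly_times_exp_neg_tendsto_0[OF assms, of "pCons 0 p"]
          filterlim_inverse_at_top_right]
      by (simp add: inverse_eq_divide)
    then have "((\<lambda>h. (flat c p h - flat c p 0) / h) \<longlongrightarrow> 0) (at_right 0)"
      by (rule Lim_transform_eventually)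
        (auto simp: eventually_at_right_less flat_def field_simps intro: eventually_at_rightI[of 0 1])
    moreover have "((\<lambda>h. (flat c p h - flat c p 0) / h) \<longlongrightarrow> 0) (at_left 0)"
      by (rule Lim_transform_eventually[OF tendsto_const])
        (auto simp: flat_def intro!: eventually_at_leftI[of "-1" 0])
    ultimately show ?thesis
      using 3 by (simp add: has_field_derivative_iff filterlim_at_split flat_def)
  qed
qed

text \<open>
  Smoothness of bump functions is proved by exhibiting a class of differentiable functions that
  contains them and is closed under differentiation. By the product rule, sums of products of
  two one-sided flat functions form such a class.
\<close>

inductive_set flat_products :: "real \<Rightarrow> real \<Rightarrow> real \<Rightarrow> (real \<Rightarrow> real) set" for a b c where
  mult: "(\<lambda>x. flat c p (x - a) * flat c q (b - x)) \<in> flat_products a b c"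
| add: "f \<in> flat_products a b c \<Longrightarrow> g \<in> flat_products a b c \<Longrightarrow> (\<lambda>x. f x + g x) \<in> flat_products a b c"

lemma flat_products_has_derivative:
  assumes "0 < c" "f \<in> flat_products a b c"
  shows "\<exists>f'\<in>flat_products a b c. \<forall>x. (f has_real_derivative f' x) (at x)"
  using assms(2)
proof induction
  case (mult p q)
  let ?d = "\<lambda>p. monom 1 2 * (smult c p - pderiv p)"
  let ?f' = "\<lambda>x. flat c (?d p) (x - a) * flat c q (b - x) + flat c p (x - a) * flat c (- ?d q) (b - x)"
  have "((\<lambda>x. flat c p (x - a) * flat c q (b - x)) has_real_derivative ?f' x) (at x)" for x
  proof -
    have 1: "((\<lambda>x. flat c p (x - a)) has_real_derivative flat c (?d p) (x - a)) (at x)"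
      by (rule DERIV_chain2[OF flat_has_derivative[OF assms(1)], THEN DERIV_cong])
        (auto intro!: derivative_eq_intros)
    have 2: "((\<lambda>x. flat c q (b - x)) has_real_derivative flat c (- ?d q) (b - x)) (at x)"
      by (rule DERIV_chain2[OF flat_has_derivative[OF assms(1)], THEN DERIV_cong])
        (auto intro!: derivative_eq_intros simp: flat_def)
    show ?thesis
      using DERIV_mult[OF 1 2] by (simp add: mult.commute)
  qed
  moreover have "?f' \<in> flat_products a b c"
    by (intro flat_products.intros)
  ultimately show ?case by (intro bexI[of _ ?f'] allI)
next
  case (add f g)
  then obtain f' g' where "f' \<in> flat_products a b c" "g' \<in> flat_products a b c"
    "\<And>x. (f has_real_derivative f' x) (at x)" "\<And>x. (g has_real_derivative g' x) (at x)" by blast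
  then show ?case
    by (intro bexI[of _ "\<lambda>x. f' x + g' x"]) (auto intro: DERIV_add flat_products.add)
qed

text \<open>
  The product is strictly positive exactly on the open interval from \<open>a\<close> to \<open>b\<close>, and increases to
  its indicator function as \<open>c\<close> decreases to \<open>0\<close>.
\<close>

definition bump :: "real \<Rightarrow> real \<Rightarrow> real \<Rightarrow> real \<Rightarrow> real" where
  "bump a b c x = flat c 1 (x - a) * flat c 1 (b - x)"

lemma bump_test_function:
  assumes "0 < c" "{a..b} \<subseteq> A"
  shows "bump a b c \<in> test_functions A"
proof -
  have "(deriv ^^ n) (bump a b c) \<in> flat_products a b c" for n
  proof (induction n)
    case 0
    have "bump a b c = (\<lambda>x. flat c 1 (x - a) * flat c 1 (b - x))"
      by (simp add: bump_def fun_eq_iff)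
    then show ?case by (simp add: flat_products.mult)
  next
    case (Suc n)
    from flat_products_has_derivative[OF assms(1) this] obtain f' where
      f': "f' \<in> flat_products a b c" "\<And>x. ((deriv ^^ n) (bump a b c) has_real_derivative f' x) (at x)"
      by blast
    then have "deriv ((deriv ^^ n) (bump a b c)) = f'"
      by (intro ext DERIV_imp_deriv) auto
    with f' show ?case by simp
  qed
  then have "(deriv ^^ n) (bump a b c) field_differentiable at x" for n x
    using flat_products_has_derivative[OF assms(1)] unfolding field_differentiable_def by blast
  moreover have "\<forall>x. x \<notin> {a..b} \<longrightarrow> bump a b c x = 0"
    by (auto simp: bump_def flat_def)
  ultimately show ?thesis
    using assms(2) unfolding test_functions_def by (blast intro: compact_Icc)
qed

lemma bump_bounds:
  assumes "0 < c"
  shows "0 \<le> bump a b c x" "bump a b c x \<le> indicator {a<..<b} x" "bump a b c x \<le> 1"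
proof -
  have *: "0 \<le> flat c 1 y" "flat c 1 y \<le> 1" for y
    using assms by (auto simp: flat_def)
  show "0 \<le> bump a b c x" using * by (simp add: bump_def)
  show "bump a b c x \<le> 1"
    unfolding bump_def using * by (intro mult_le_one) auto
  moreover have "x \<notin> {a<..<b} \<Longrightarrow> bump a b c x = 0"
    by (auto simp: bump_def flat_def)
  ultimately show "bump a b c x \<le> indicator {a<..<b} x"
    by (cases "x \<in> {a<..<b}") auto
qed

lemma bump_tendsto_indicator:
  assumes c: "c \<longlonglongrightarrow> 0"
  shows "(\<lambda>n. bump a b (c n) x) \<longlonglongrightarrow> indicator {a<..<b} x"
proof (cases "x \<in> {a<..<b}")
  case True
  have "(\<lambda>n. exp (- c n / (x - a)) * exp (- c n / (b - x))) \<longlonglongrightarrow> exp (- 0 / (x - a)) * exp (- 0 / (b - x))"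
    using True by (intro tendsto_intros c) auto
  with True show ?thesis by (simp add: bump_def flat_def)
next
  case False
  then have "bump a b (c n) x = 0" for n by (auto simp: bump_def flat_def)
  with False show ?thesis by simp
qed

section \<open>Uniqueness of weak derivatives\<close>

text \<open>
  Open intervals form a generator of the Borel sets that is closed under intersection, so by Dynkin's
  argument the integral of \<open>f\<close> vanishes over every Borel set.
\<close>

lemma AE_zero_if_interval_integrals_zero:
  fixes f :: "real \<Rightarrow> 'a::{second_countable_topology,banach}"
  assumes f: "integrable lborel f"
    and zero: "\<And>a b. (LINT x:{a<..<b}|lborel. f x) = 0"
  shows "AE x in lborel. f x = 0"
proof (rule sigma_finite_measure.density_zero[OF sigma_finite_lborel f])
  have si: "set_integrable lborel S f" if "S \<in> sets lborel" for S
    using f that unfolding set_integrable_def by (rule integrable_mult_indicator[rotated])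
  have union_lemma: "(LINT x:(\<Union>i::nat. S i)|lborel. f x) = 0"
    if "\<And>i. S i \<in> sets lborel" "\<And>i. (LINT x:S i|lborel. f x) = 0" "disjoint_family S" for S
  proof -
    have "(LINT x:(\<Union>i. S i)|lborel. f x) = (\<Sum>i. LINT x:S i|lborel. f x)"
      using that by (intro lebesgue_integral_countable_add si)
        (auto simp: disjoint_family_on_def intro: sets.countable_UN)
    then show ?thesis using that by simp
  qed
  have "(\<lambda>n. LINT x:{-real n<..<real n}|lborel. f x) \<longlonglongrightarrow> (LINT x:(\<Union>n. {-real n<..<real n})|lborel. f x)"
    by (rule set_integral_cont_up) (auto simp: incseq_def intro!: si)
  moreover have "(\<Union>n. {-real n<..<real n}) = (UNIV :: real set)"
  proof -
    have "\<exists>n. - real n < x \<and> x < real n" for x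
      using reals_Archimedean2[of "\<bar>x\<bar>"] unfolding abs_less_iff by (metis minus_less_iff)
    then show ?thesis by auto
  qed
  ultimately have UNIV: "(LINT x:UNIV|lborel. f x) = 0"
    by (simp add: zero LIMSEQ_const_iff)
  fix S :: "real set" assume "S \<in> sets lborel"
  then have S: "S \<in> sigma_sets UNIV (range (\<lambda>(a, b). box a b))"
    unfolding sets_lborel borel_eq_box by (simp del: box_real)
  have borel: "S \<in> sets borel" if "S \<in> sigma_sets UNIV (range (\<lambda>(a, b). box a b))" for S :: "real set"
    using that unfolding borel_eq_box by (simp del: box_real)
  have closed: "range (\<lambda>(a, b). box a b) \<subseteq> Pow (UNIV :: real set)"
    by simp
  have "Int_stable (range (\<lambda>(a, b). box a b :: real set))"
    by (auto simp: Int_stable_def box_Int_box image_def) (metis box_real(1))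
  from this closed S show "(LINT x:S|lborel. f x) = 0"
  proof (induction rule: sigma_sets_induct_disjoint)
    case (basic S) then show ?case by (auto simp: zero box_real)
  next
    case empty show ?case by (simp add: set_lebesgue_integral_def)
  next
    case (compl S)
    have "(LINT x:(UNIV - S) \<union> S|lborel. f x) = (LINT x:(UNIV - S)|lborel. f x) + (LINT x:S|lborel. f x)"
      using borel[OF compl(1)] by (intro set_integral_Un si) auto
    with compl UNIV show ?case by simp
  next
    case (union S)
    then have "S i \<in> sets lborel" for i using borel by auto
    with union show ?case by (intro union_lemma)
  qed
qed

text \<open>
  The majorant \<open>1 + |v|\<^sup>2\<close> of \<open>|v|\<close> is integrable on bounded intervals.
\<close>

lemma L2_set_integrable_Icc:
  assumes "v \<in> L2_space A" "{a..b} \<subseteq> A"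
  shows "set_integrable lborel {a..b} v"
proof -
  have v: "set_borel_measurable lborel A v" "set_integrable lborel A (\<lambda>x. (cmod (v x))\<^sup>2)"
    using assms(1) by (auto simp: L2_space_def)
  have eq: "(\<lambda>x. indicator {a..b} x *\<^sub>R v x) = (\<lambda>x. indicator {a..b} x *\<^sub>R (indicator A x *\<^sub>R v x))"
    using assms(2) by (auto simp: fun_eq_iff indicator_def)
  have "(\<lambda>x. indicator A x *\<^sub>R v x) \<in> borel_measurable lborel"
    using v(1) by (simp add: set_borel_measurable_def)
  then have meas: "(\<lambda>x. indicator {a..b} x *\<^sub>R v x) \<in> borel_measurable lborel"
    unfolding eq by (intro borel_measurable_scaleR[of "indicator {a..b}"]) auto
  have "integrable lborel (\<lambda>x. indicator {a..b} x + indicator A x *\<^sub>R (cmod (v x))\<^sup>2 :: real)"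
    using v(2) by (intro Bochner_Integration.integrable_add integrable_real_indicator)
      (auto simp: set_integrable_def emeasure_lborel_Icc_eq)
  then show ?thesis
    unfolding set_integrable_def
  proof (rule Bochner_Integration.integrable_bound[OF _ meas], intro AE_I2)
    fix x
    have "2 * cmod (v x) \<le> 1 + (cmod (v x))\<^sup>2"
      using zero_le_power2[of "cmod (v x) - 1"] by (simp add: power2_eq_square algebra_simps)
    then have "cmod (v x) \<le> 1 + (cmod (v x))\<^sup>2"
      using norm_ge_zero[of "v x"] by linarith
    then show "norm (indicator {a..b} x *\<^sub>R v x) \<le> norm (indicator {a..b} x + indicator A x *\<^sub>R (cmod (v x))\<^sup>2 :: real)"
      using assms(2) by (auto simp: indicator_def)
  qed
qed

text \<open>
  Test both weak derivatives against bumps that increase to the indicator of the interval, and pass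
  to the limit by dominated convergence.
\<close>

lemma weak_deriv_diff_integral_zero:
  assumes v: "v \<in> L2_space A" "is_weak_deriv A u v"
    and w: "w \<in> L2_space A" "is_weak_deriv A u w"
    and ab: "{a..b} \<subseteq> A"
  shows "(LINT x:{a<..<b}|lborel. v x - w x) = 0"
proof -
  let ?c = "\<lambda>n::nat. 1 / real (Suc n)"
  let ?f = "\<lambda>n x. indicator {a..b} x *\<^sub>R ((v x - w x) * complex_of_real (bump a b (?c n) x))"
  have int: "integrable lborel (\<lambda>x. indicator {a..b} x *\<^sub>R z x)"
    if "z \<in> L2_space A" for z
    using L2_set_integrable_Icc[OF that ab] by (simp add: set_integrable_def)
  have bump_meas: "bump a b (?c n) \<in> borel_measurable borel" for n
  proof -
    have "\<forall>x. bump a b (?c n) field_differentiable at x"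
      using bump_test_function[of "?c n" a b UNIV] by (auto simp: test_functions_def dest: spec[of _ 0])
    then show ?thesis
      by (intro borel_measurable_continuous_onI)
        (auto simp: continuous_on_eq_continuous_at intro: field_differentiable_imp_continuous_at)
  qed
  have on_Icc: "(LINT x:A|lborel. z x * complex_of_real (bump a b c x)) =
      (LINT x|lborel. indicator {a..b} x *\<^sub>R (z x * complex_of_real (bump a b c x)))" if "0 < c" for z c
    using ab bump_bounds[OF that, of a b] unfolding set_lebesgue_integral_def
    by (intro Bochner_Integration.integral_cong refl)
      (auto simp: indicator_def bump_def flat_def)
  have intb: "integrable lborel (\<lambda>x. indicator {a..b} x *\<^sub>R (z x * complex_of_real (bump a b (?c n) x)))"
    if z: "z \<in> L2_space A" for z n
  proof (rule Bochner_Integration.integrable_bound[OF int[OF z]])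
    have "(\<lambda>x. (indicator {a..b} x *\<^sub>R z x) * complex_of_real (bump a b (?c n) x)) \<in> borel_measurable lborel"
      using borel_measurable_integrable[OF int[OF z]] bump_meas by measurable
    then show "(\<lambda>x. indicator {a..b} x *\<^sub>R (z x * complex_of_real (bump a b (?c n) x))) \<in> borel_measurable lborel"
      by simp
    have "\<bar>bump a b (?c n) x\<bar> \<le> 1" for x
      using bump_bounds[of "?c n" a b x] by auto
    then show "AE x in lborel. norm (indicator {a..b} x *\<^sub>R (z x * complex_of_real (bump a b (?c n) x))) \<le> norm (indicator {a..b} x *\<^sub>R z x)"
      by (intro AE_I2) (auto simp: norm_mult indicator_def intro: mult_left_le)
  qed
  have zero: "(LINT x|lborel. ?f n x) = 0" for n
  proof -
    have bump: "bump a b (?c n) \<in> test_functions A"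
      using ab by (intro bump_test_function) auto
    have "(LINT x:A|lborel. v x * complex_of_real (bump a b (?c n) x)) = (LINT x:A|lborel. w x * complex_of_real (bump a b (?c n) x))"
      using bspec[OF v(2)[unfolded is_weak_deriv_def] bump] bspec[OF w(2)[unfolded is_weak_deriv_def] bump]
      by simp
    then have "(LINT x|lborel. indicator {a..b} x *\<^sub>R (v x * complex_of_real (bump a b (?c n) x))) =
       (LINT x|lborel. indicator {a..b} x *\<^sub>R (w x * complex_of_real (bump a b (?c n) x)))"
      by (simp only: on_Icc zero_less_divide_1_iff of_nat_0_less_iff zero_less_Suc)
    then show ?thesis
      using Bochner_Integration.integral_diff[OF intb[OF v(1), of n] intb[OF w(1), of n]]
      by (simp add: algebra_simps)
  qed
  have dom: "integrable lborel (\<lambda>x. norm (indicator {a..b} x *\<^sub>R v x) + norm (indicator {a..b} x *\<^sub>R w x))"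
    using int v w by (intro Bochner_Integration.integrable_add integrable_norm) auto
  have meas: "(\<lambda>x. indicator {a<..<b} x *\<^sub>R (v x - w x)) \<in> borel_measurable lborel"
  proof -
    have "(\<lambda>x. indicator {a<..<b} x *\<^sub>R (indicator {a..b} x *\<^sub>R v x - indicator {a..b} x *\<^sub>R w x)) \<in> borel_measurable lborel"
      using borel_measurable_integrable[OF int[OF v(1)]] borel_measurable_integrable[OF int[OF w(1)]]
      by measurable
    also have "(\<lambda>x. indicator {a<..<b} x *\<^sub>R (indicator {a..b} x *\<^sub>R v x - indicator {a..b} x *\<^sub>R w x)) =
       (\<lambda>x. indicator {a<..<b} x *\<^sub>R (v x - w x))"
      by (auto simp: fun_eq_iff indicator_def)
    finally show ?thesis .
  qed
  have "(\<lambda>n. LINT x|lborel. ?f n x) \<longlonglongrightarrow> (LINT x|lborel. indicator {a<..<b} x *\<^sub>R (v x - w x))"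
  proof (rule integral_dominated_convergence[OF meas _ dom])
    show "?f n \<in> borel_measurable lborel" for n
      using borel_measurable_integrable[OF Bochner_Integration.integrable_diff[OF intb[OF v(1), of n] intb[OF w(1), of n]]]
      by (simp add: algebra_simps)
    show "AE x in lborel. (\<lambda>n. ?f n x) \<longlonglongrightarrow> indicator {a<..<b} x *\<^sub>R (v x - w x)"
    proof (rule AE_I2)
      fix x
      have "(\<lambda>n. ?f n x) \<longlonglongrightarrow> indicator {a..b} x *\<^sub>R ((v x - w x) * complex_of_real (indicator {a<..<b} x))"
        by (intro tendsto_intros bump_tendsto_indicator LIMSEQ_Suc[OF lim_1_over_n])
      then show "(\<lambda>n. ?f n x) \<longlonglongrightarrow> indicator {a<..<b} x *\<^sub>R (v x - w x)"
        by (auto simp: indicator_def split: if_splits)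
    qed
    have "norm (?f n x) \<le> norm (indicator {a..b} x *\<^sub>R v x) + norm (indicator {a..b} x *\<^sub>R w x)" for n x
    proof -
      have "\<bar>bump a b (?c n) x\<bar> \<le> 1"
        using bump_bounds[of "?c n" a b x] by auto
      then have "cmod (v x - w x) * \<bar>bump a b (?c n) x\<bar> \<le> cmod (v x - w x)"
        by (intro mult_left_le) auto
      also have "\<dots> \<le> cmod (v x) + cmod (w x)" by (rule norm_triangle_ineq4)
      finally show ?thesis by (auto simp: norm_mult indicator_def)
    qed
    then show "AE x in lborel. norm (?f n x) \<le> norm (indicator {a..b} x *\<^sub>R v x) + norm (indicator {a..b} x *\<^sub>R w x)" for n
      by (intro AE_I2)
  qed
  then show ?thesis
    by (simp only: zero LIMSEQ_const_iff set_lebesgue_integral_def)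
qed

text \<open>
  The difference \<open>v - w\<close> has integral zero over all subintervals of a compact interval inside \<open>A\<close>, so it
  vanishes almost everywhere there; the interiors of countably many such intervals, those with
  rational endpoints, cover \<open>A\<close>.
\<close>

lemma weak_deriv_unique:
  assumes A: "open A"
    and v: "v \<in> L2_space A" "is_weak_deriv A u v"
    and w: "w \<in> L2_space A" "is_weak_deriv A u w"
  shows "AE x in lborel. x \<in> A \<longrightarrow> v x = w x"
proof -
  have local: "AE x in lborel. x \<in> {c<..<d} \<longrightarrow> v x = w x" if cd: "{c..d} \<subseteq> A" for c d
  proof -
    let ?f = "\<lambda>x. indicator {c<..<d} x *\<^sub>R (v x - w x)"
    have "set_integrable lborel {c..d} (\<lambda>x. v x - w x)"
      using v w cd by (intro set_integral_diff L2_set_integrable_Icc) auto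
    then have "set_integrable lborel {c<..<d} (\<lambda>x. v x - w x)"
      by (rule set_integrable_subset) auto
    then have int: "integrable lborel ?f"
      by (simp add: set_integrable_def)
    have zero: "(LINT x:{a<..<b}|lborel. ?f x) = 0" for a b
    proof -
      have "(LINT x:{a<..<b}|lborel. ?f x) = (LINT x:{max a c<..<min b d}|lborel. v x - w x)"
        unfolding set_lebesgue_integral_def
        by (intro Bochner_Integration.integral_cong refl) (auto simp: indicator_def)
      also have "\<dots> = 0"
        using cd by (intro weak_deriv_diff_integral_zero[OF v w]) auto
      finally show ?thesis .
    qed
    show ?thesis
      using AE_zero_if_interval_integrals_zero[OF int zero]
      by eventually_elim (auto simp: indicator_def)
  qed
  have "AE x in lborel. \<forall>q\<in>\<rat> \<times> \<rat>. {fst q..snd q} \<subseteq> A \<longrightarrow> x \<in> {fst q<..<snd q} \<longrightarrow> v x = w x"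
  proof (subst AE_ball_countable)
    show "countable (\<rat> \<times> \<rat> :: (real \<times> real) set)" by (intro countable_SIGMA countable_rat)
    show "\<forall>q\<in>\<rat> \<times> \<rat>. AE x in lborel. {fst q..snd q} \<subseteq> A \<longrightarrow> x \<in> {fst q<..<snd q} \<longrightarrow> v x = w x"
      using local[of "fst q" "snd q" for q] by (intro ballI AE_impI) blast
  qed
  then show ?thesis
  proof eventually_elim
    case (elim x)
    show ?case
    proof
      assume "x \<in> A"
      then obtain e where e: "e > 0" "ball x e \<subseteq> A" using A open_contains_ball by blast
      obtain p where p: "p \<in> \<rat>" "x - e < p" "p < x" using Rats_dense_in_real[of "x - e" x] e by auto
      obtain q where q: "q \<in> \<rat>" "x < q" "q < x + e" using Rats_dense_in_real[of x "x + e"] e by auto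
      have "{p..q} \<subseteq> A" using p q e(2) by (force simp: ball_def dist_real_def)
      then show "v x = w x" using elim p q by (auto dest!: bspec[of _ _ "(p, q)"])
    qed
  qed
qed


section \<open>Piecewise continuously differentiable functions\<close>

text \<open>
  The support lies in the interior of a bounded interval, so \<open>\<phi>\<close> vanishes at both of its endpoints; this
  removes the boundary terms when integrating by parts. Off the support the derivative vanishes as
  well because the complement of a compact set is open.
\<close>

lemma test_function_C1:
  assumes "\<phi> \<in> test_functions A"
  shows "\<And>x. (\<phi> has_real_derivative deriv \<phi> x) (at x)" "continuous_on S \<phi>" "continuous_on S (deriv \<phi>)"
    "\<exists>c d. c \<le> d \<and> (\<forall>x. x \<notin> A \<or> x \<notin> {c<..<d} \<longrightarrow> \<phi> x = 0 \<and> deriv \<phi> x = 0)"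
proof -
  have diff: "(deriv ^^ n) \<phi> field_differentiable at x" for n x
    using assms by (auto simp: test_functions_def)
  show D: "(\<phi> has_real_derivative deriv \<phi> x) (at x)" for x
    using diff[of 0 x] by (simp add: field_differentiable_derivI)
  show "continuous_on S \<phi>"
    using diff[of 0] by (auto intro!: continuous_at_imp_continuous_on field_differentiable_imp_continuous_at)
  show "continuous_on S (deriv \<phi>)"
    using diff[of 1] by (auto intro!: continuous_at_imp_continuous_on field_differentiable_imp_continuous_at)
  obtain K where K: "compact K" "K \<subseteq> A" "\<And>x. x \<notin> K \<Longrightarrow> \<phi> x = 0"
    using assms by (auto simp: test_functions_def)
  obtain M where M: "K \<subseteq> {-M<..<M}" "M > 0"
  proof -
    obtain B where "\<forall>x\<in>K. norm x < B" "B > 0" using compact_imp_bounded[OF K(1)] by (auto simp: bounded_pos_less)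
    then show ?thesis by (intro that[of B]) (auto simp: abs_less_iff minus_less_iff)
  qed
  have "deriv \<phi> x = 0" if "x \<notin> K" for x
  proof -
    have "\<forall>\<^sub>F y in nhds x. \<phi> y = 0"
      using eventually_nhds_in_open[of "- K" x] that K(3) compact_imp_closed[OF K(1)]
      by (auto simp: open_Compl elim!: eventually_mono)
    then have "deriv \<phi> x = deriv (\<lambda>_. 0) x" by (rule deriv_cong_ev) simp
    then show ?thesis by simp
  qed
  moreover have "x \<notin> K" if "x \<notin> A \<or> x \<notin> {-M<..<M}" for x
    using that K(2) M(1) by blast
  ultimately show "\<exists>c d. c \<le> d \<and> (\<forall>x. x \<notin> A \<or> x \<notin> {c<..<d} \<longrightarrow> \<phi> x = 0 \<and> deriv \<phi> x = 0)"
    using K(3) M(2) by (intro exI[of _ "-M"] exI[of _ M] conjI allI impI) (simp_all only: neg_le_iff_le, auto)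
qed

text \<open>
  This is integration by parts for \<open>U \<phi>\<close>, where the boundary terms vanish together with \<open>\<phi>\<close>. The function \<open>u\<close> may differ from \<open>U\<close> off \<open>A\<close>, which permits a
  jump at the origin when \<open>A\<close> is a half line.
\<close>

lemma is_weak_deriv_if_C1:
  fixes U U' u :: "real \<Rightarrow> complex"
  assumes U: "\<And>x. (U has_vector_derivative U' x) (at x)" and U': "continuous_on UNIV U'"
    and u: "\<And>x. x \<in> A \<Longrightarrow> u x = U x"
  shows "is_weak_deriv A u U'"
  unfolding is_weak_deriv_def
proof
  fix \<phi> assume \<phi>: "\<phi> \<in> test_functions A"
  note D = test_function_C1(1)[OF \<phi>] and cont = test_function_C1(2,3)[OF \<phi>]
  obtain c d where cd: "c \<le> d" "\<And>x. x \<notin> A \<or> x \<notin> {c<..<d} \<Longrightarrow> \<phi> x = 0 \<and> deriv \<phi> x = 0"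
    using test_function_C1(4)[OF \<phi>] by blast
  have U_cont: "continuous_on S U" for S
    using U by (auto intro!: continuous_at_imp_continuous_on has_vector_derivative_continuous)
  have U'_cont: "continuous_on S U'" for S
    using U' by (rule continuous_on_subset) simp
  let ?p = "\<lambda>x. U x * complex_of_real (deriv \<phi> x)" and ?q = "\<lambda>x. U' x * complex_of_real (\<phi> x)"
  have ints: "set_integrable lborel {c..d} ?p" "set_integrable lborel {c..d} ?q"
    unfolding set_integrable_def
    by (intro borel_integrable_compact compact_Icc continuous_intros U_cont U'_cont cont)+
  have "(LINT x|lborel. indicator {c..d} x *\<^sub>R (?p x + ?q x)) = U d * complex_of_real (\<phi> d) - U c * complex_of_real (\<phi> c)"
  proof (rule integral_FTC_atLeastAtMost[OF cd(1)])
    show "((\<lambda>x. U x * complex_of_real (\<phi> x)) has_vector_derivative ?p x + ?q x) (at x within {c..d})" for x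
      by (rule has_vector_derivative_mult[THEN has_vector_derivative_at_within])
       (auto intro!: U has_vector_derivative_of_real D)
    show "continuous_on {c..d} (\<lambda>x. ?p x + ?q x)"
      by (intro continuous_intros U_cont U'_cont cont)
  qed
  also have "\<dots> = 0" using cd(2)[of c] cd(2)[of d] by simp
  finally have "(LINT x:{c..d}|lborel. ?p x) + (LINT x:{c..d}|lborel. ?q x) = 0"
    using set_integral_add(2)[OF ints] by (simp add: set_lebesgue_integral_def)
  moreover have "(LINT x:A|lborel. u x * complex_of_real (deriv \<phi> x)) = (LINT x:{c..d}|lborel. ?p x)"
    unfolding set_lebesgue_integral_def using u cd(2)
    by (intro Bochner_Integration.integral_cong refl) (force simp: indicator_def)
  moreover have "(LINT x:A|lborel. ?q x) = (LINT x:{c..d}|lborel. ?q x)"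
    unfolding set_lebesgue_integral_def using cd(2)
    by (intro Bochner_Integration.integral_cong refl) (force simp: indicator_def)
  ultimately show "(LINT x:A|lborel. u x * complex_of_real (deriv \<phi> x)) = - (LINT x:A|lborel. ?q x)"
    by (simp add: eq_neg_iff_add_eq_0)
qed

lemma L2_space_if_dominated:
  fixes U u :: "real \<Rightarrow> complex"
  assumes A: "A \<in> sets borel" and U: "continuous_on UNIV U" and u: "\<And>x. x \<in> A \<Longrightarrow> u x = U x"
    and h: "set_integrable lborel A (\<lambda>x. (h x)\<^sup>2)" and le: "\<And>x. x \<in> A \<Longrightarrow> cmod (U x) \<le> h x"
  shows "u \<in> L2_space A" "L2_norm_sq A u \<le> (LINT x:A|lborel. (h x)\<^sup>2)"
proof -
  have eq: "(\<lambda>x. indicator A x *\<^sub>R u x) = (\<lambda>x. indicator A x *\<^sub>R U x)"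
    using u by (auto simp: fun_eq_iff indicator_def)
  have [measurable]: "U \<in> borel_measurable borel" "A \<in> sets borel"
    using U A by (auto intro: borel_measurable_continuous_onI)
  have m: "(\<lambda>x. indicator A x *\<^sub>R u x) \<in> borel_measurable lborel"
    unfolding eq by measurable
  have eq2: "(\<lambda>x. indicator A x *\<^sub>R (cmod (u x))\<^sup>2) = (\<lambda>x. (cmod (indicator A x *\<^sub>R u x))\<^sup>2)"
    by (auto simp: fun_eq_iff indicator_def)
  have le2: "indicator A x *\<^sub>R (cmod (u x))\<^sup>2 \<le> indicator A x *\<^sub>R (h x)\<^sup>2" for x
    using le[of x] u[of x] by (auto simp: indicator_def intro!: power_mono)
  have "integrable lborel (\<lambda>x. indicator A x *\<^sub>R (cmod (u x))\<^sup>2)"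
  proof (rule Bochner_Integration.integrable_bound)
    show "integrable lborel (\<lambda>x. indicator A x *\<^sub>R (h x)\<^sup>2)"
      using h by (simp add: set_integrable_def)
    show "(\<lambda>x. indicator A x *\<^sub>R (cmod (u x))\<^sup>2) \<in> borel_measurable lborel"
      unfolding eq2 using m by measurable
    show "AE x in lborel. norm (indicator A x *\<^sub>R (cmod (u x))\<^sup>2) \<le> norm (indicator A x *\<^sub>R (h x)\<^sup>2)"
      using le2 by (intro AE_I2) (auto simp: indicator_def)
  qed
  then have s: "set_integrable lborel A (\<lambda>x. (cmod (u x))\<^sup>2)"
    by (simp add: set_integrable_def)
  then show "u \<in> L2_space A"
    using m by (auto simp: L2_space_def set_borel_measurable_def)
  show "L2_norm_sq A u \<le> (LINT x:A|lborel. (h x)\<^sup>2)"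
    unfolding L2_norm_sq_def using le u by (intro set_integral_mono s h) (auto intro!: power_mono)
qed

text \<open>
  By uniqueness, the weak derivative that \<open>weak_deriv\<close> selects agrees almost everywhere with the
  classical one, so the Sobolev norm can be computed classically.
\<close>

lemma H1_if_C1:
  assumes A: "open A"
    and U: "\<And>x. (U has_vector_derivative U' x) (at x)" and U': "continuous_on UNIV U'"
    and u: "\<And>x. x \<in> A \<Longrightarrow> u x = U x"
    and L2: "U \<in> L2_space A" "U' \<in> L2_space A"
  shows "u \<in> H1_space A" "H1_norm_sq A u = L2_norm_sq A U + L2_norm_sq A U'"
proof -
  have uL2: "u \<in> L2_space A"
  proof -
    have "(\<lambda>x. indicator A x *\<^sub>R u x) = (\<lambda>x. indicator A x *\<^sub>R U x)"
      "(\<lambda>x. indicator A x *\<^sub>R (cmod (u x))\<^sup>2) = (\<lambda>x. indicator A x *\<^sub>R (cmod (U x))\<^sup>2)"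
      using u by (auto simp: fun_eq_iff indicator_def)
    with L2(1) show ?thesis
      by (simp add: L2_space_def set_borel_measurable_def set_integrable_def)
  qed
  have wd: "is_weak_deriv A u U'" by (rule is_weak_deriv_if_C1[OF U U' u])
  show "u \<in> H1_space A" using uL2 L2 wd by (auto simp: H1_space_def)
  have "weak_deriv A u \<in> L2_space A \<and> is_weak_deriv A u (weak_deriv A u)"
    unfolding weak_deriv_def by (rule someI[of _ U']) (use L2 wd in simp)
  then have wL2: "weak_deriv A u \<in> L2_space A" and "is_weak_deriv A u (weak_deriv A u)" by auto
  then have "AE x in lborel. x \<in> A \<longrightarrow> weak_deriv A u x = U' x"
    by (rule weak_deriv_unique[OF A _ _ L2(2) wd])
  then have "AE x in lborel. indicator A x *\<^sub>R (cmod (weak_deriv A u x))\<^sup>2 = indicator A x *\<^sub>R (cmod (U' x))\<^sup>2"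
    by eventually_elim (auto simp: indicator_def)
  then have "L2_norm_sq A (weak_deriv A u) = L2_norm_sq A U'"
    using wL2 L2 unfolding L2_norm_sq_def set_lebesgue_integral_def
    by (intro integral_cong_AE) (auto simp: L2_space_def set_integrable_def)
  moreover have "L2_norm_sq A u = L2_norm_sq A U"
    unfolding L2_norm_sq_def set_lebesgue_integral_def using u
    by (intro Bochner_Integration.integral_cong refl) (auto simp: indicator_def)
  ultimately show "H1_norm_sq A u = L2_norm_sq A U + L2_norm_sq A U'"
    by (simp add: H1_norm_sq_def)
qed

text \<open>
  One real function \<open>h\<close> bounds both \<open>u\<close> and its derivative on each half line, where \<open>u\<close> agrees with a
  continuously differentiable function on the whole line. The point of such bounds is that they add up
  under linear combinations, which reduces estimates of the norm in \<open>Q_space\<close> to integrals of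
  nonnegative scalar functions.
\<close>

definition H1_dominated :: "(real \<Rightarrow> complex) \<Rightarrow> (real \<Rightarrow> real) \<Rightarrow> bool" where
  "H1_dominated u h \<longleftrightarrow> (\<forall>A\<in>{{0<..}, {..<0}}. \<exists>U U'.
     (\<forall>x. (U has_vector_derivative U' x) (at x)) \<and> continuous_on UNIV U' \<and>
     (\<forall>x\<in>A. u x = U x \<and> cmod (U x) \<le> h x \<and> cmod (U' x) \<le> h x))"

lemma H1_dominated_linear:
  assumes "H1_dominated u g" "H1_dominated v h"
  shows "H1_dominated (\<lambda>x. a * u x + b * v x) (\<lambda>x. cmod a * g x + cmod b * h x)"
  unfolding H1_dominated_def
proof
  fix A :: "real set" assume A: "A \<in> {{0<..}, {..<0}}"
  obtain U U' where U: "\<And>x. (U has_vector_derivative U' x) (at x)" "continuous_on UNIV U'"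
    "\<And>x. x \<in> A \<Longrightarrow> u x = U x \<and> cmod (U x) \<le> g x \<and> cmod (U' x) \<le> g x"
    using bspec[OF assms(1)[unfolded H1_dominated_def] A] by auto
  obtain V V' where V: "\<And>x. (V has_vector_derivative V' x) (at x)" "continuous_on UNIV V'"
    "\<And>x. x \<in> A \<Longrightarrow> v x = V x \<and> cmod (V x) \<le> h x \<and> cmod (V' x) \<le> h x"
    using bspec[OF assms(2)[unfolded H1_dominated_def] A] by auto
  have le: "cmod (a * y + b * z) \<le> cmod a * s + cmod b * t" if "cmod y \<le> s" "cmod z \<le> t" for y z s t
    using norm_triangle_ineq[of "a * y" "b * z"] mult_left_mono[OF that(1), of "cmod a"] mult_left_mono[OF that(2), of "cmod b"]
    by (simp add: norm_mult)
  show "\<exists>W W'. (\<forall>x. (W has_vector_derivative W' x) (at x)) \<and> continuous_on UNIV W' \<and>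
     (\<forall>x\<in>A. a * u x + b * v x = W x \<and> cmod (W x) \<le> cmod a * g x + cmod b * h x \<and>
        cmod (W' x) \<le> cmod a * g x + cmod b * h x)"
  proof (rule exI[of _ "\<lambda>x. a * U x + b * V x"], rule exI[of _ "\<lambda>x. a * U' x + b * V' x"], intro conjI allI ballI)
    show "((\<lambda>x. a * U x + b * V x) has_vector_derivative a * U' x + b * V' x) (at x)" for x
      by (intro has_vector_derivative_add has_vector_derivative_mult_right U V)
    show "continuous_on UNIV (\<lambda>x. a * U' x + b * V' x)"
      by (intro continuous_intros U V)
  qed (use U(3) V(3) le in auto)
qed

lemma H1_dominated_mono:
  assumes "H1_dominated u g" "\<And>x. g x \<le> h x"
  shows "H1_dominated u h"
  using assms unfolding H1_dominated_def by (meson order_trans)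

text \<open>
  The factor \<open>2\<close> arises because \<open>h\<close> bounds both the function and its derivative.
\<close>

lemma Q_space_if_H1_dominated:
  assumes dom: "H1_dominated u h" and h: "integrable lborel (\<lambda>x. (h x)\<^sup>2)"
  shows "u \<in> Q_space" "(Q_norm u)\<^sup>2 \<le> 2 * (LINT x|lborel. (h x)\<^sup>2)"
proof -
  have half: "u \<in> H1_space A \<and> 0 \<le> H1_norm_sq A u \<and> H1_norm_sq A u \<le> 2 * (LINT x:A|lborel. (h x)\<^sup>2)"
    if A: "A \<in> {{0<..}, {..<0}}" for A
  proof -
    obtain U U' where U: "\<And>x. (U has_vector_derivative U' x) (at x)" "continuous_on UNIV U'"
      "\<And>x. x \<in> A \<Longrightarrow> u x = U x" "\<And>x. x \<in> A \<Longrightarrow> cmod (U x) \<le> h x" "\<And>x. x \<in> A \<Longrightarrow> cmod (U' x) \<le> h x"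
      using bspec[OF dom[unfolded H1_dominated_def] A] by auto
    have op: "open A" using A by auto
    then have meas: "A \<in> sets borel" by simp
    have cont: "continuous_on UNIV U"
      using U(1) by (auto intro!: continuous_at_imp_continuous_on has_vector_derivative_continuous)
    have hA: "set_integrable lborel A (\<lambda>x. (h x)\<^sup>2)"
      unfolding set_integrable_def using h meas by (intro integrable_mult_indicator) auto
    have L2: "U \<in> L2_space A" "U' \<in> L2_space A"
      "L2_norm_sq A U \<le> (LINT x:A|lborel. (h x)\<^sup>2)" "L2_norm_sq A U' \<le> (LINT x:A|lborel. (h x)\<^sup>2)"
      using L2_space_if_dominated[OF meas cont refl hA U(4)] L2_space_if_dominated[OF meas U(2) refl hA U(5)]
      by auto
    have "0 \<le> L2_norm_sq A V" for V
      unfolding L2_norm_sq_def set_lebesgue_integral_def by (intro integral_nonneg_AE AE_I2) auto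
    with H1_if_C1[OF op U(1,2,3) L2(1,2)] L2(3,4) show ?thesis by simp
  qed
  then show "u \<in> Q_space" by (auto simp: Q_space_def)
  have hA: "set_integrable lborel A (\<lambda>x. (h x)\<^sup>2)" if "A \<in> sets borel" for A
    unfolding set_integrable_def using h that by (intro integrable_mult_indicator) auto
  have "(Q_norm u)\<^sup>2 = H1_norm_sq {0<..} u + H1_norm_sq {..<0} u"
    using half by (simp add: Q_norm_def)
  also have "\<dots> \<le> 2 * ((LINT x:{0<..}|lborel. (h x)\<^sup>2) + (LINT x:{..<0}|lborel. (h x)\<^sup>2))"
    using half[of "{0<..}"] half[of "{..<0}"] by auto
  also have "(LINT x:{0<..}|lborel. (h x)\<^sup>2) + (LINT x:{..<0}|lborel. (h x)\<^sup>2) = (LINT x:{0<..} \<union> {..<0}|lborel. (h x)\<^sup>2)"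
    by (intro set_integral_Un[symmetric] hA) auto
  also have "\<dots> \<le> (LINT x|lborel. (h x)\<^sup>2)"
    unfolding set_lebesgue_integral_def
    using hA[of "{0<..} \<union> {..<0}"] h by (intro integral_mono) (auto simp: set_integrable_def indicator_def)
  finally show "(Q_norm u)\<^sup>2 \<le> 2 * (LINT x|lborel. (h x)\<^sup>2)" by simp
qed

lemma H1_dominated_zero: "H1_dominated (\<lambda>x. 0) (\<lambda>x. 0)"
  unfolding H1_dominated_def by (auto intro!: exI[of _ "\<lambda>_. 0"])

lemma zero_in_Q_space: "(\<lambda>x. 0) \<in> Q_space"
  using H1_dominated_zero by (rule Q_space_if_H1_dominated) simp

lemma Q_dual_linear:
  assumes "\<Phi> \<in> Q_dual" "v \<in> Q_space" "w \<in> Q_space"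
  shows "\<Phi> (\<lambda>x. a * v x + b * w x) = a * \<Phi> v + b * \<Phi> w"
  using assms by (simp add: Q_dual_def)

lemma Q_dual_zero: "\<Phi> \<in> Q_dual \<Longrightarrow> \<Phi> (\<lambda>x. 0) = 0"
  using Q_dual_linear[of \<Phi> "\<lambda>x. 0" "\<lambda>x. 0" 0 0] by (simp add: zero_in_Q_space)

lemma Q_norm_nonneg: "0 \<le> Q_norm u"
proof -
  have "0 \<le> L2_norm_sq A V" for A V
    unfolding L2_norm_sq_def set_lebesgue_integral_def by (intro integral_nonneg_AE AE_I2) auto
  then show ?thesis by (auto simp: Q_norm_def H1_norm_sq_def)
qed

lemma Q_norm_le_if_H1_dominated:
  assumes "H1_dominated u h" "integrable lborel (\<lambda>x. (h x)\<^sup>2)"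
  shows "Q_norm u \<le> sqrt (2 * (LINT x|lborel. (h x)\<^sup>2))"
  using Q_space_if_H1_dominated(2)[OF assms] by (intro real_le_rsqrt)

section \<open>Convergence in the two topologies\<close>

lemma limitin_Q_strong_topologyI:
  assumes E: "E \<in> Q_space"
    and "\<forall>\<^sub>F l in F. u l \<in> Q_space" "((\<lambda>l. Q_norm (\<lambda>x. u l x - E x)) \<longlongrightarrow> 0) F"
  shows "limitin Q_strong_topology u E F"
  unfolding limitin_def
proof (intro conjI allI impI)
  have "openin Q_strong_topology Q_space"
    unfolding openin_Q_strong_topology by (auto intro: exI[of _ 1])
  then show "E \<in> topspace Q_strong_topology"
    using E openin_subset by blast
  fix V assume "openin Q_strong_topology V \<and> E \<in> V"
  then obtain e where e: "e > 0" "\<And>v. v \<in> Q_space \<Longrightarrow> Q_norm (\<lambda>x. v x - E x) < e \<Longrightarrow> v \<in> V"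
    unfolding openin_Q_strong_topology by blast
  have "\<forall>\<^sub>F l in F. Q_norm (\<lambda>x. u l x - E x) < e"
    using assms(3) e(1) by (rule order_tendstoD)
  with assms(2) show "\<forall>\<^sub>F l in F. u l \<in> V"
    by eventually_elim (rule e(2))
qed

text \<open>
  Eventual membership passes to finite intersections and to unions, so it is enough to check it on the
  generating sets.
\<close>

lemma limitin_topology_generated_byI:
  assumes "x \<in> \<Union>S" "\<And>W. W \<in> S \<Longrightarrow> x \<in> W \<Longrightarrow> \<forall>\<^sub>F l in F. f l \<in> W"
  shows "limitin (topology_generated_by S) f x F"
  unfolding limitin_def
proof (intro conjI allI impI)
  show "x \<in> topspace (topology_generated_by S)" using assms(1) by simp
  fix U assume "openin (topology_generated_by S) U \<and> x \<in> U"
  then have "generate_topology_on S U" "x \<in> U"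
    by (auto simp: openin_topology_generated_by_iff)
  then show "\<forall>\<^sub>F l in F. f l \<in> U"
  proof induction
    case (Int a b)
    then show ?case by (auto intro: eventually_conj)
  next
    case (UN K)
    then obtain k where k: "k \<in> K" "x \<in> k" by blast
    with UN have "\<forall>\<^sub>F l in F. f l \<in> k" by blast
    then show ?case by eventually_elim (use k in blast)
  qed (use assms(2) in auto)
qed

lemma limitin_Q_weak_topologyI:
  assumes E: "E \<in> Q_space"
    and u: "\<forall>\<^sub>F l in F. u l \<in> Q_space"
    and lim: "\<And>\<Phi>. \<Phi> \<in> Q_dual \<Longrightarrow> ((\<lambda>l. \<Phi> (u l)) \<longlongrightarrow> \<Phi> E) F"
  shows "limitin Q_weak_topology u E F"
  unfolding Q_weak_topology_def
proof (rule limitin_topology_generated_byI)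
  have "(\<lambda>_. 0) \<in> Q_dual" by (auto simp: Q_dual_def intro: exI[of _ 0])
  with E show "E \<in> \<Union>{{u \<in> Q_space. \<Phi> u \<in> U} |\<Phi> U. \<Phi> \<in> Q_dual \<and> open U}"
    by (intro UnionI[of "{u \<in> Q_space. (0::complex) \<in> UNIV}"]) (auto intro!: exI[of _ "\<lambda>_. 0"] exI[of _ UNIV])
  fix W assume "W \<in> {{u \<in> Q_space. \<Phi> u \<in> U} |\<Phi> U. \<Phi> \<in> Q_dual \<and> open U}" "E \<in> W"
  then obtain \<Phi> U where W: "W = {u \<in> Q_space. \<Phi> u \<in> U}" "\<Phi> \<in> Q_dual" "open U" "\<Phi> E \<in> U" by auto
  have "\<forall>\<^sub>F l in F. \<Phi> (u l) \<in> U"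
    using lim[OF W(2)] W(3,4) by (auto dest: topological_tendstoD)
  with u show "\<forall>\<^sub>F l in F. u l \<in> W"
    by eventually_elim (simp add: W(1))
qed

section \<open>Functionals along flattening profiles\<close>

lemma integrable_power2_bounded:
  fixes h :: "real \<Rightarrow> real"
  assumes "integrable lborel h" "\<And>x. 0 \<le> h x" "\<And>x. h x \<le> B"
  shows "integrable lborel (\<lambda>x. (h x)\<^sup>2)"
proof (rule Bochner_Integration.integrable_bound)
  show "integrable lborel (\<lambda>x. B * h x)" using assms(1) by simp
  show "(\<lambda>x. (h x)\<^sup>2) \<in> borel_measurable lborel"
    using borel_measurable_integrable[OF assms(1)] by measurable
  have "(h x)\<^sup>2 \<le> B * h x" for x
    using assms(2,3)[of x] by (simp add: power2_eq_square mult_right_mono)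
  moreover have "B \<ge> 0" using assms(2,3)[of 0] by linarith
  ultimately show "AE x in lborel. norm ((h x)\<^sup>2) \<le> norm (B * h x)"
    using assms(2) by (intro AE_I2) (simp add: abs_mult)
qed

text \<open>
  The mixed term is small if \<open>g\<close> is low, however large its square integral is: the overlap of \<open>h\<close> and
  \<open>g\<close> is at most the height of \<open>g\<close> times the integral of \<open>h\<close>.
\<close>

lemma integral_power2_add_le:
  fixes g h :: "real \<Rightarrow> real"
  assumes h: "integrable lborel h" "\<And>x. 0 \<le> h x" "\<And>x. h x \<le> B"
    and g: "integrable lborel g" "\<And>x. 0 \<le> g x" "\<And>x. g x \<le> s"
  shows "(LINT x|lborel. (h x + g x)\<^sup>2)
      \<le> (LINT x|lborel. (h x)\<^sup>2) + 2 * s * (LINT x|lborel. h x) + (LINT x|lborel. (g x)\<^sup>2)"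
proof -
  note i = integrable_power2_bounded[OF h] integrable_power2_bounded[OF g]
  have "integrable lborel (\<lambda>x. (h x + g x)\<^sup>2)"
    using h g by (intro integrable_power2_bounded[where B = "B + s"]) (auto intro: add_mono)
  then have "(LINT x|lborel. (h x + g x)\<^sup>2) \<le> (LINT x|lborel. (h x)\<^sup>2 + 2 * s * h x + (g x)\<^sup>2)"
  proof (rule integral_mono)
    show "integrable lborel (\<lambda>x. (h x)\<^sup>2 + 2 * s * h x + (g x)\<^sup>2)"
      using i h by simp
    show "(h x + g x)\<^sup>2 \<le> (h x)\<^sup>2 + 2 * s * h x + (g x)\<^sup>2" for x
      using mult_left_mono[OF g(3)[of x] h(2)[of x]] by (simp add: power2_sum mult_ac)
  qed
  also have "\<dots> = (LINT x|lborel. (h x)\<^sup>2) + 2 * s * (LINT x|lborel. h x) + (LINT x|lborel. (g x)\<^sup>2)"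
    using i h by simp
  finally show ?thesis .
qed

text \<open>
  Suppose \<open>|\<Phi> (u l)| \<ge> \<epsilon>\<close> frequently. Choose profiles one after the other, each so low that its
  overlap with the sum of the previous bounds is at most one half, and add them with phases that make
  their values under \<open>\<Phi>\<close> positive. After \<open>N\<close> steps the squared norm is at most
  \<open>2 N (M + 1)\<close> whereas the value of \<open>\<Phi>\<close> is at least \<open>N \<epsilon>\<close>; for large \<open>N\<close> this contradicts the
  boundedness of \<open>\<Phi>\<close>.
\<close>

lemma Q_dual_tendsto_0:
  fixes u :: "'i \<Rightarrow> real \<Rightarrow> complex" and g :: "'i \<Rightarrow> real \<Rightarrow> real"
  assumes \<Phi>: "\<Phi> \<in> Q_dual"
    and u: "\<forall>\<^sub>F l in F. H1_dominated (u l) (g l) \<and> integrable lborel (g l) \<and>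
             (\<forall>x. 0 \<le> g l x \<and> g l x \<le> s l) \<and> (LINT x|lborel. (g l x)\<^sup>2) \<le> M"
    and s: "(s \<longlongrightarrow> 0) F"
  shows "((\<lambda>l. \<Phi> (u l)) \<longlongrightarrow> 0) F"
proof (rule ccontr)
  assume "\<not> ?thesis"
  then obtain \<epsilon> where \<epsilon>: "\<epsilon> > 0" "\<not> (\<forall>\<^sub>F l in F. cmod (\<Phi> (u l)) < \<epsilon>)"
    by (auto simp: tendsto_iff)
  from \<Phi> obtain C where C: "\<And>v. v \<in> Q_space \<Longrightarrow> cmod (\<Phi> v) \<le> C * Q_norm v"
    unfolding Q_dual_def by blast
  have sums: "\<exists>v h B. H1_dominated v h \<and> integrable lborel h \<and> (\<forall>x. 0 \<le> h x \<and> h x \<le> B) \<and>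
      (LINT x|lborel. (h x)\<^sup>2) \<le> real N * (M + 1) \<and> real N * \<epsilon> \<le> Re (\<Phi> v)" for N :: nat
  proof (induction N)
    case 0
    show ?case
      using H1_dominated_zero Q_dual_zero[OF \<Phi>] by (intro exI[of _ "\<lambda>_. 0"] exI[of _ 0]) auto
  next
    case (Suc N)
    then obtain v h B where v: "H1_dominated v h" "integrable lborel h" "\<And>x. 0 \<le> h x" "\<And>x. h x \<le> B"
      "(LINT x|lborel. (h x)\<^sup>2) \<le> real N * (M + 1)" "real N * \<epsilon> \<le> Re (\<Phi> v)" by blast
    have "((\<lambda>l. 2 * s l * (LINT x|lborel. h x)) \<longlongrightarrow> 2 * 0 * (LINT x|lborel. h x)) F"
      by (intro tendsto_intros s)
    then have "\<forall>\<^sub>F l in F. 2 * s l * (LINT x|lborel. h x) < 1"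
      by (rule order_tendstoD) simp
    with u have good: "\<forall>\<^sub>F l in F. 2 * s l * (LINT x|lborel. h x) < 1 \<and> H1_dominated (u l) (g l) \<and> integrable lborel (g l) \<and>
             (\<forall>x. 0 \<le> g l x \<and> g l x \<le> s l) \<and> (LINT x|lborel. (g l x)\<^sup>2) \<le> M"
      by eventually_elim auto
    have "\<exists>\<^sub>F l in F. \<not> cmod (\<Phi> (u l)) < \<epsilon>"
      using \<epsilon>(2) by (simp add: not_eventually)
    from frequently_ex[OF frequently_eventually_frequently[OF this good]]
    obtain l where l: "2 * s l * (LINT x|lborel. h x) < 1" "H1_dominated (u l) (g l)" "integrable lborel (g l)"
       "\<And>x. 0 \<le> g l x" "\<And>x. g l x \<le> s l" "(LINT x|lborel. (g l x)\<^sup>2) \<le> M" "\<epsilon> \<le> cmod (\<Phi> (u l))"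
      by (auto simp: not_less)
    \<comment> \<open>The phase that rotates \<open>\<Phi> (u l)\<close> to the positive real axis.\<close>
    define c where "c = cnj (sgn (\<Phi> (u l)))"
    have "cmod c \<le> 1" by (simp add: c_def norm_sgn)
    have "c * \<Phi> (u l) = of_real (cmod (\<Phi> (u l)))"
      using complex_norm_square[of "\<Phi> (u l)"]
      by (cases "\<Phi> (u l) = 0") (simp_all add: c_def sgn_eq field_simps power2_eq_square)
    moreover have "v \<in> Q_space" "u l \<in> Q_space"
      using v l by (blast intro: Q_space_if_H1_dominated integrable_power2_bounded)+
    ultimately have "\<Phi> (\<lambda>x. 1 * v x + c * u l x) = \<Phi> v + of_real (cmod (\<Phi> (u l)))"
      using Q_dual_linear[OF \<Phi>, of v "u l" 1 c] by simp
    then have Re: "real (Suc N) * \<epsilon> \<le> Re (\<Phi> (\<lambda>x. 1 * v x + c * u l x))"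
      using v(6) l(7) by (simp add: algebra_simps)
    have dom: "H1_dominated (\<lambda>x. 1 * v x + c * u l x) (\<lambda>x. h x + g l x)"
      using H1_dominated_linear[OF v(1) l(2), of 1 c]
      by (rule H1_dominated_mono) (use \<open>cmod c \<le> 1\<close> l(4) in \<open>auto intro: mult_left_le_one_le\<close>)
    have "(LINT x|lborel. (h x + g l x)\<^sup>2) \<le> real (Suc N) * (M + 1)"
      using integral_power2_add_le[OF v(2-4) l(3-5)] v(5) l(1,6) by (simp add: algebra_simps)
    moreover have "\<forall>x. 0 \<le> h x + g l x \<and> h x + g l x \<le> B + s l"
      using v l by (auto intro: add_mono)
    moreover have "integrable lborel (\<lambda>x. h x + g l x)"
      using v(2) l(3) by (rule Bochner_Integration.integrable_add)
    ultimately show ?case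
      using Re dom by (intro exI conjI)
  qed
  \<comment> \<open>Squaring \<open>N \<epsilon> \<le> C sqrt (2 N (M + 1))\<close> bounds \<open>N\<close>, so any larger \<open>N\<close> is impossible.\<close>
  obtain N where N: "real N > 2 * C\<^sup>2 * (M + 1) / \<epsilon>\<^sup>2" "N > 0"
    by (metis gr0I of_nat_0_less_iff reals_Archimedean2 less_trans max_less_iff_conj)
  from sums[of N] obtain v h B where v: "H1_dominated v h" "integrable lborel h" "\<And>x. 0 \<le> h x" "\<And>x. h x \<le> B"
      "(LINT x|lborel. (h x)\<^sup>2) \<le> real N * (M + 1)" "real N * \<epsilon> \<le> Re (\<Phi> v)" by blast
  note h2 = integrable_power2_bounded[OF v(2-4)]
  have "real N * \<epsilon> \<le> C * Q_norm v"
    using v(6) complex_Re_le_cmod[of "\<Phi> v"] C[OF Q_space_if_H1_dominated(1)[OF v(1) h2]] by linarith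
  then have "(real N * \<epsilon>)\<^sup>2 \<le> (C * Q_norm v)\<^sup>2"
    using \<epsilon> by (intro power_mono) auto
  also have "\<dots> \<le> C\<^sup>2 * (2 * (real N * (M + 1)))"
    using Q_space_if_H1_dominated(2)[OF v(1) h2] v(5) unfolding power_mult_distrib
    by (intro mult_left_mono) auto
  finally have "real N * (real N * \<epsilon>\<^sup>2) \<le> real N * (2 * C\<^sup>2 * (M + 1))"
    by (simp add: power_mult_distrib power2_eq_square mult_ac)
  then have "real N * \<epsilon>\<^sup>2 \<le> 2 * C\<^sup>2 * (M + 1)"
    using N(2) by (subst (asm) mult_le_cancel_left_pos) auto
  with N(1) \<epsilon>(1) show False
    by (simp add: field_simps)
qed

section \<open>Solitons\<close>

lemma sech_bounds: "0 < sech x" "sech x \<le> 1"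
  using cosh_real_ge_1[of x] by (auto simp: sech_def)

lemma sech_has_derivative: "(sech has_real_derivative - tanh x * sech x) (at x)"
  unfolding sech_def [abs_def]
  by (auto intro!: derivative_eq_intros simp: tanh_def power2_eq_square field_simps)

lemma sech_affine_has_derivative:
  "((\<lambda>x. sech (k * (x - p))) has_real_derivative - (k * tanh (k * (x - p)) * sech (k * (x - p)))) (at x)"
  by (rule DERIV_chain2[OF sech_has_derivative, THEN DERIV_cong]) (auto intro!: derivative_eq_intros)

lemma sech_power2: "(sech x)\<^sup>2 = 1 - (tanh x)\<^sup>2"
proof -
  have "1 - (tanh x)\<^sup>2 = ((cosh x)\<^sup>2 - (sinh x)\<^sup>2) / (cosh x)\<^sup>2"
    using cosh_real_nonzero[of x] by (simp add: tanh_def power_divide diff_divide_distrib)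
  also have "\<dots> = (sech x)\<^sup>2"
    by (simp only: hyperbolic_pythagoras) (simp add: sech_def power_divide)
  finally show ?thesis by simp
qed

lemma continuous_on_sech [continuous_intros]:
  "continuous_on S f \<Longrightarrow> continuous_on S (\<lambda>x. sech (f x))"
  unfolding sech_def by (intro continuous_intros) (auto simp: cosh_real_nonzero)

lemma borel_measurable_sech [measurable]: "sech \<in> borel_measurable borel"
  by (intro borel_measurable_continuous_onI continuous_intros)

lemma filterlim_affine_at_top_bot:
  fixes k p :: real
  assumes "0 < k"
  shows "filterlim (\<lambda>x. k * (x - p)) at_top at_top" "filterlim (\<lambda>x. k * (x - p)) at_bot at_bot"
proof -
  show "filterlim (\<lambda>x. k * (x - p)) at_top at_top"
    using assms by (auto simp: filterlim_at_top eventually_at_top_linorder field_simps intro!: exI[of _ "_ / k + p"])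
  show "filterlim (\<lambda>x. k * (x - p)) at_bot at_bot"
    using assms by (auto simp: filterlim_at_bot eventually_at_bot_linorder field_simps intro!: exI[of _ "_ / k + p"])
qed

text \<open>
  The antiderivative \<open>arctan \<circ> sinh\<close> (the Gudermannian function) is bounded.
\<close>

lemma integrable_sech:
  assumes "0 < k"
  shows "integrable lborel (\<lambda>x. sech (k * (x - p)))"
proof -
  have "set_integrable lborel (einterval (-\<infinity>) \<infinity>) (\<lambda>x. sech (k * (x - p)))"
  proof (rule interval_integral_FTC_nonneg)
    show "((\<lambda>x. arctan (sinh (k * (x - p))) / k) has_real_derivative sech (k * (x - p))) (at x)" for x
    proof -
      have "1 + (sinh y)\<^sup>2 = (cosh y)\<^sup>2" for y :: real
        using hyperbolic_pythagoras[of y] by simp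
      with assms show ?thesis
        by (auto intro!: derivative_eq_intros simp: sech_def power2_eq_square field_simps)
    qed
    have "continuous_on UNIV (\<lambda>x. sech (k * (x - p)))" by (intro continuous_intros)
    then show "isCont (\<lambda>x. sech (k * (x - p))) x" for x
      by (simp add: continuous_on_eq_continuous_at)
    have "((\<lambda>x. arctan (sinh (k * (x - p))) / k) \<longlongrightarrow> (pi / 2) / k) at_top"
      using assms by (intro tendsto_intros filterlim_compose[OF tendsto_arctan_at_top]
         filterlim_compose[OF sinh_real_at_top] filterlim_affine_at_top_bot) auto
    then show "(((\<lambda>x. arctan (sinh (k * (x - p))) / k) \<circ> real_of_ereal) \<longlongrightarrow> pi / 2 / k) (at_left \<infinity>)"
      by (simp add: ereal_tendsto_simps)
    have "((\<lambda>x. arctan (sinh (k * (x - p))) / k) \<longlongrightarrow> (- (pi / 2)) / k) at_bot"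
      using assms by (intro tendsto_intros filterlim_compose[OF tendsto_arctan_at_bot]
         filterlim_compose[OF sinh_real_at_bot] filterlim_affine_at_top_bot) auto
    then show "(((\<lambda>x. arctan (sinh (k * (x - p))) / k) \<circ> real_of_ereal) \<longlongrightarrow> - (pi / 2) / k) (at_right (-\<infinity>))"
      by (simp add: ereal_tendsto_simps)
  qed (use sech_bounds(1) in \<open>auto intro: less_imp_le\<close>)
  then show ?thesis by (simp add: set_integrable_def)
qed

lemma integral_sech_power2_half_line:
  assumes "0 < k"
  shows "set_integrable lborel {0<..} (\<lambda>x. (sech (k * (x - q)))\<^sup>2)"
    "(LINT x:{0<..}|lborel. (sech (k * (x - q)))\<^sup>2) = (1 + tanh (k * q)) / k"
    "set_integrable lborel {..<0} (\<lambda>x. (sech (k * (x - q)))\<^sup>2)"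
    "(LINT x:{..<0}|lborel. (sech (k * (x - q)))\<^sup>2) = (1 - tanh (k * q)) / k"
proof -
  let ?F = "\<lambda>x. tanh (k * (x - q)) / k" and ?f = "\<lambda>x. (sech (k * (x - q)))\<^sup>2"
  have D: "(?F has_real_derivative ?f x) (at x)" for x
    using assms by (auto intro!: derivative_eq_intros simp: sech_power2 cosh_real_nonzero)
  have "continuous_on UNIV ?f" by (intro continuous_intros)
  then have cont: "isCont ?f x" for x by (simp add: continuous_on_eq_continuous_at)
  have lim0: "(?F \<longlongrightarrow> ?F 0) (at 0)"
    using DERIV_isCont[OF D[of 0]] by (simp add: isCont_def)
  have top: "(?F \<longlongrightarrow> 1 / k) at_top"
    using assms by (intro tendsto_intros filterlim_compose[OF tanh_real_at_top] filterlim_affine_at_top_bot) auto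
  have bot: "(?F \<longlongrightarrow> - 1 / k) at_bot"
    using assms by (intro tendsto_intros filterlim_compose[OF tanh_real_at_bot] filterlim_affine_at_top_bot) auto
  have 0: "((?F \<circ> real_of_ereal) \<longlongrightarrow> ?F 0) (at_right (ereal 0))" "((?F \<circ> real_of_ereal) \<longlongrightarrow> ?F 0) (at_left (ereal 0))"
    using lim0 unfolding ereal_tendsto_simps by (auto simp: filterlim_at_split)
  have infty: "((?F \<circ> real_of_ereal) \<longlongrightarrow> 1 / k) (at_left \<infinity>)" "((?F \<circ> real_of_ereal) \<longlongrightarrow> - 1 / k) (at_right (-\<infinity>))"
    using top bot unfolding ereal_tendsto_simps by auto
  have pos: "AE x in lborel. a < ereal x \<longrightarrow> ereal x < b \<longrightarrow> 0 \<le> ?f x" for a b by simp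
  note R = interval_integral_FTC_nonneg[OF _ D cont pos 0(1) infty(1)]
  note L = interval_integral_FTC_nonneg[OF _ D cont pos infty(2) 0(2)]
  show "set_integrable lborel {0<..} ?f" "set_integrable lborel {..<0} ?f"
    using R(1) L(1) by simp_all
  show "(LINT x:{0<..}|lborel. ?f x) = (1 + tanh (k * q)) / k"
    using R(2) by (simp add: interval_lebesgue_integral_def add_divide_distrib)
  show "(LINT x:{..<0}|lborel. ?f x) = (1 - tanh (k * q)) / k"
    using L(2) by (simp add: interval_lebesgue_integral_def diff_divide_distrib)
qed

text \<open>
  This is the common form of the three families. The sign \<open>\<sigma>\<close> of the left branch is \<open>- 1\<close> for
  the odd family and \<open>1\<close> for the other two.
\<close>

definition two_solitons :: "real \<Rightarrow> real \<Rightarrow> real \<Rightarrow> real \<Rightarrow> real \<Rightarrow> real \<Rightarrow> complex" where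
  "two_solitons \<sigma> A k p q x =
     of_real (if x < 0 then \<sigma> * A * sech (k * (x - p)) else A * sech (k * (x - q)))"

text \<open>
  The common amplitude uses \<open>sqrt (2 \<omega> / l) = sqrt (2 / l) sqrt \<omega>\<close>, which isolates the dependence on \<open>l\<close>.
\<close>

lemma psi_eq_two_solitons:
  "psi_even l \<omega> = two_solitons 1 (sqrt (2 / l) * sqrt \<omega>) (sqrt \<omega>) 0 0"
  "psi_asym s \<gamma> l \<omega> = two_solitons 1 (sqrt (2 / l) * sqrt \<omega>) (sqrt \<omega>) (x1 s \<gamma> \<omega>) (x2 s \<gamma> \<omega>)"
  "psi_odd \<gamma> l \<omega> = two_solitons (- 1) (sqrt (2 / l) * sqrt \<omega>) (sqrt \<omega>) (xbar \<gamma> \<omega>) (- xbar \<gamma> \<omega>)"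
proof -
  have "sqrt (2 * \<omega> / l) = sqrt (2 / l) * sqrt \<omega>"
    by (simp flip: real_sqrt_mult)
  then show "psi_even l \<omega> = two_solitons 1 (sqrt (2 / l) * sqrt \<omega>) (sqrt \<omega>) 0 0"
    "psi_asym s \<gamma> l \<omega> = two_solitons 1 (sqrt (2 / l) * sqrt \<omega>) (sqrt \<omega>) (x1 s \<gamma> \<omega>) (x2 s \<gamma> \<omega>)"
    "psi_odd \<gamma> l \<omega> = two_solitons (- 1) (sqrt (2 / l) * sqrt \<omega>) (sqrt \<omega>) (xbar \<gamma> \<omega>) (- xbar \<gamma> \<omega>)"
    by (auto simp: fun_eq_iff psi_even_def psi_asym_def psi_odd_def two_solitons_def)
qed

lemma L2_norm_sq_two_solitons:
  assumes "0 < k" "\<bar>\<sigma>\<bar> = 1"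
  shows "L2_norm_sq UNIV (two_solitons \<sigma> A k p q) = A\<^sup>2 / k * (2 - tanh (k * p) + tanh (k * q))"
proof -
  let ?f = "\<lambda>p x. (sech (k * (x - p)))\<^sup>2"
  have \<sigma>: "\<sigma>\<^sup>2 = 1" using assms(2) by (metis power2_abs one_power2)
  \<comment> \<open>The definition by cases puts the origin into the right half line.\<close>
  have set: "(LINT x:{0..}|lborel. ?f q x) = (LINT x:{0<..}|lborel. ?f q x)"
    using AE_lborel_singleton[of 0]
    by (intro set_integral_cong_set) (auto simp: set_borel_measurable_def elim!: eventually_mono)
  have si: "set_integrable lborel {0..} (?f q)"
  proof -
    have "AE x in lborel. indicator {0<..} x *\<^sub>R ?f q x = indicator {0..} x *\<^sub>R ?f q x"
      using AE_lborel_singleton[of 0] by eventually_elim (auto simp: indicator_def)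
    then show ?thesis
      using integral_sech_power2_half_line(1)[OF assms(1), of q] unfolding set_integrable_def
      by (subst integrable_cong_AE[symmetric]) auto
  qed
  have "L2_norm_sq UNIV (two_solitons \<sigma> A k p q) =
     (LINT x|lborel. A\<^sup>2 * (indicator {..<0} x *\<^sub>R ?f p x) + A\<^sup>2 * (indicator {0..} x *\<^sub>R ?f q x))"
    unfolding L2_norm_sq_def set_lebesgue_integral_def
    by (intro Bochner_Integration.integral_cong refl)
      (auto simp: two_solitons_def indicator_def norm_mult power_mult_distrib \<sigma> simp flip: of_real_mult)
  also have "\<dots> = A\<^sup>2 * (LINT x:{..<0}|lborel. ?f p x) + A\<^sup>2 * (LINT x:{0..}|lborel. ?f q x)"
    unfolding set_lebesgue_integral_def
    using si integral_sech_power2_half_line(3)[OF assms(1), of p] unfolding set_integrable_def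
    by (subst Bochner_Integration.integral_add)
      (simp_all only: integrable_mult_right integral_mult_right_zero)
  also have "\<dots> = A\<^sup>2 * ((1 - tanh (k * p)) / k) + A\<^sup>2 * ((1 + tanh (k * q)) / k)"
    unfolding set integral_sech_power2_half_line(2,4)[OF assms(1)] ..
  finally show ?thesis
    by (simp add: algebra_simps add_divide_distrib diff_divide_distrib)
qed

lemma cmod_two_solitons:
  assumes "\<bar>\<sigma>\<bar> = 1"
  shows "cmod (two_solitons \<sigma> A k p q x) = \<bar>A\<bar> * sech (k * (x - (if x < 0 then p else q)))"
  using assms sech_bounds(1)[of "k * (x - p)"] sech_bounds(1)[of "k * (x - q)"]
  by (simp add: two_solitons_def norm_mult abs_mult del: of_real_mult)

lemma integrable_cmod_two_solitons:
  assumes "0 < k" "\<bar>\<sigma>\<bar> = 1"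
  shows "integrable lborel (\<lambda>x. cmod (two_solitons \<sigma> A k p q x))"
proof (rule Bochner_Integration.integrable_bound)
  show "integrable lborel (\<lambda>x. \<bar>A\<bar> * (sech (k * (x - p)) + sech (k * (x - q))))"
    using integrable_sech[OF assms(1)] by simp
  show "(\<lambda>x. cmod (two_solitons \<sigma> A k p q x)) \<in> borel_measurable lborel"
    unfolding two_solitons_def by measurable
  show "AE x in lborel. norm (cmod (two_solitons \<sigma> A k p q x))
      \<le> norm (\<bar>A\<bar> * (sech (k * (x - p)) + sech (k * (x - q))))"
    using sech_bounds(1) unfolding cmod_two_solitons[OF assms(2)]
    by (intro AE_I2) (auto simp: abs_mult less_imp_le intro!: mult_left_mono)
qed

text \<open>
  The derivative of \<open>sech (k x)\<close> is \<open>- k tanh (k x) sech (k x)\<close>, and \<open>|tanh| < 1\<close>; so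
  the profile itself controls its derivative, up to the factor \<open>k\<close>.
\<close>

lemma H1_dominated_two_solitons:
  assumes "0 < k" "\<bar>\<sigma>\<bar> = 1"
  shows "H1_dominated (two_solitons \<sigma> A k p q) (\<lambda>x. max 1 k * cmod (two_solitons \<sigma> A k p q x))"
proof -
  have C1: "\<exists>U U'. (\<forall>x. (U has_vector_derivative U' x) (at x)) \<and> continuous_on UNIV U' \<and>
     (\<forall>x\<in>S. two_solitons \<sigma> A k p q x = U x \<and>
       cmod (U x) \<le> max 1 k * cmod (two_solitons \<sigma> A k p q x) \<and>
       cmod (U' x) \<le> max 1 k * cmod (two_solitons \<sigma> A k p q x))"
    if eq: "\<And>x. x \<in> S \<Longrightarrow> two_solitons \<sigma> A k p q x = of_real (B * sech (k * (x - r)))" for S B r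
  proof -
    let ?U = "\<lambda>x. complex_of_real (B * sech (k * (x - r)))"
    let ?U' = "\<lambda>x. complex_of_real (B * - (k * tanh (k * (x - r)) * sech (k * (x - r))))"
    have D: "\<forall>x. (?U has_vector_derivative ?U' x) (at x)"
      by (intro allI has_vector_derivative_of_real DERIV_cmult sech_affine_has_derivative)
    have cont: "continuous_on UNIV ?U'"
      by (intro continuous_intros) (auto simp: cosh_real_nonzero)
    have U': "cmod (?U' x) \<le> k * cmod (?U x)" for x
    proof -
      have "\<bar>tanh (k * (x - r))\<bar> \<le> 1" using tanh_real_bounds[of "k * (x - r)"] by auto
      then have "\<bar>tanh (k * (x - r))\<bar> * (k * \<bar>B * sech (k * (x - r))\<bar>) \<le> 1 * (k * \<bar>B * sech (k * (x - r))\<bar>)"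
        using assms(1) by (intro mult_right_mono) auto
      then show ?thesis
        using assms(1) unfolding norm_of_real by (simp add: abs_mult mult_ac)
    qed
    have le: "b * cmod (?U x) \<le> max 1 k * cmod (?U x)" if "b \<le> max 1 k" for b x
      using that by (intro mult_right_mono) auto
    have bounds: "cmod (?U x) \<le> max 1 k * cmod (?U x)" "cmod (?U' x) \<le> max 1 k * cmod (?U x)" for x
      using le[OF max.cobounded1, of x] order_trans[OF U' le[OF max.cobounded2]]
      by (simp_all only: mult_1)
    have "\<forall>x\<in>S. two_solitons \<sigma> A k p q x = ?U x \<and>
        cmod (?U x) \<le> max 1 k * cmod (two_solitons \<sigma> A k p q x) \<and>
        cmod (?U' x) \<le> max 1 k * cmod (two_solitons \<sigma> A k p q x)"
    proof
      fix x assume "x \<in> S"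
      show "two_solitons \<sigma> A k p q x = ?U x \<and>
        cmod (?U x) \<le> max 1 k * cmod (two_solitons \<sigma> A k p q x) \<and>
        cmod (?U' x) \<le> max 1 k * cmod (two_solitons \<sigma> A k p q x)"
        unfolding eq[OF \<open>x \<in> S\<close>] by (intro conjI refl bounds)
    qed
    with D cont show ?thesis by (intro exI conjI)
  qed
  show ?thesis
    unfolding H1_dominated_def
  proof
    fix S :: "real set" assume "S \<in> {{0<..}, {..<0}}"
    then consider "S = {0<..}" | "S = {..<0}" by blast
    then show "\<exists>U U'. (\<forall>x. (U has_vector_derivative U' x) (at x)) \<and> continuous_on UNIV U' \<and>
      (\<forall>x\<in>S. two_solitons \<sigma> A k p q x = U x \<and>
        cmod (U x) \<le> max 1 k * cmod (two_solitons \<sigma> A k p q x) \<and>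
        cmod (U' x) \<le> max 1 k * cmod (two_solitons \<sigma> A k p q x))"
    proof cases
      case 1 then show ?thesis by (intro C1[of _ A q]) (simp add: two_solitons_def)
    next
      case 2 then show ?thesis by (intro C1[of _ "\<sigma> * A" p]) (simp add: two_solitons_def)
    qed
  qed
qed

lemma member_of_mass_eq:
  assumes "\<omega> \<in> I" "L2_norm_sq UNIV (psi \<omega>) = \<rho>"
    and "\<And>\<omega>'. \<omega>' \<in> I \<Longrightarrow> L2_norm_sq UNIV (psi \<omega>') = \<rho> \<Longrightarrow> \<omega>' = \<omega>"
  shows "member_of_mass I psi \<rho> = psi \<omega>"
proof -
  have "(THE \<omega>. \<omega> \<in> I \<and> L2_norm_sq UNIV (psi \<omega>) = \<rho>) = \<omega>"
    using assms by (intro the_equality) blast+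
  then show ?thesis by (simp add: member_of_mass_def)
qed

text \<open>
  With \<open>k \<le> c l\<close> the height of the profile is at most \<open>sqrt (2 / l) c l = sqrt (2 l) c\<close>, which
  tends to \<open>0\<close>. Once \<open>c l < 1\<close>, the modulus of the profile is itself a bound in the sense of
  \<open>H1_dominated\<close>, with square integral \<open>\<rho>\<close>.
\<close>

lemma limitin_Q_weak_two_solitons:
  assumes u: "\<And>l. 0 < l \<Longrightarrow> \<exists>k p q. u l = two_solitons 1 (sqrt (2 / l) * k) k p q \<and> 0 < k \<and> k \<le> c * l
      \<and> L2_norm_sq UNIV (u l) = \<rho>"
  shows "limitin Q_weak_topology u (\<lambda>x. 0) (at_right 0)"
proof -
  define g where "g l x = cmod (u l x)" for l x
  define s where "s l = sqrt (2 * l) * c" for l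
  have "((\<lambda>l. c * l) \<longlongrightarrow> c * 0) (at_right 0)" by (intro tendsto_intros)
  then have "\<forall>\<^sub>F l in at_right 0. c * l < 1"
    by (rule order_tendstoD) simp
  then have dom: "\<forall>\<^sub>F l in at_right 0. H1_dominated (u l) (g l) \<and> integrable lborel (g l) \<and>
             (\<forall>x. 0 \<le> g l x \<and> g l x \<le> s l) \<and> (LINT x|lborel. (g l x)\<^sup>2) \<le> \<rho>"
    using eventually_at_right_less[of 0]
  proof eventually_elim
    case (elim l)
    from u[OF elim(2)] obtain k p q where k: "u l = two_solitons 1 (sqrt (2 / l) * k) k p q" "0 < k" "k \<le> c * l"
      "L2_norm_sq UNIV (u l) = \<rho>" by blast
    have "H1_dominated (u l) (g l)"
      using H1_dominated_two_solitons[OF k(2), of 1 "sqrt (2 / l) * k" p q] k(3) elim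
      unfolding g_def k(1) by simp
    moreover have "integrable lborel (g l)"
      unfolding g_def k(1) by (intro integrable_cmod_two_solitons k) simp
    moreover have "g l x \<le> s l" for x
    proof -
      have "g l x \<le> \<bar>sqrt (2 / l) * k\<bar> * 1"
        unfolding g_def k(1) cmod_two_solitons[OF abs_one] by (intro mult_left_mono sech_bounds) simp
      also have "\<dots> \<le> sqrt (2 / l) * (c * l)"
        using k elim by (auto simp: abs_mult intro!: mult_left_mono)
      also have "\<dots> = s l"
        using elim by (simp add: s_def real_sqrt_divide real_sqrt_mult field_simps)
      finally show ?thesis .
    qed
    moreover have "(LINT x|lborel. (g l x)\<^sup>2) = \<rho>"
      using k(4) by (simp add: g_def L2_norm_sq_def set_lebesgue_integral_def)
    ultimately show ?case by (auto simp: g_def)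
  qed
  have "((\<lambda>l. sqrt (2 * l) * c) \<longlongrightarrow> sqrt (2 * 0) * c) (at_right 0)" by (intro tendsto_intros)
  then have s: "(s \<longlongrightarrow> 0) (at_right 0)" by (simp add: s_def [abs_def])
  show ?thesis
  proof (rule limitin_Q_weak_topologyI[OF zero_in_Q_space])
    show "\<forall>\<^sub>F l in at_right 0. u l \<in> Q_space"
      using dom by eventually_elim (blast intro: Q_space_if_H1_dominated integrable_power2_bounded)
    fix \<Phi> assume \<Phi>: "\<Phi> \<in> Q_dual"
    then show "((\<lambda>l. \<Phi> (u l)) \<longlongrightarrow> \<Phi> (\<lambda>x. 0)) (at_right 0)"
      using Q_dual_tendsto_0[OF \<Phi> dom s] by (simp add: Q_dual_zero)
  qed
qed

section \<open>Masses of the three families\<close>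

text \<open>
  The shifts of the solitons have the form \<open>artanh t / sqrt \<omega>\<close>. Writing the half logarithm as the
  logarithm of a square root gives \<open>tanh\<close> of it as a rational function.
\<close>

lemma tanh_half_ln:
  assumes "\<bar>t::real\<bar> < 1"
  shows "tanh (ln ((1 + t) / (1 - t)) / 2) = t"
proof -
  define y where "y = (1 + t) / (1 - t)"
  have y: "y > 0" using assms by (simp add: y_def abs_less_iff)
  have "ln y / 2 = ln (sqrt y)" using y by (simp add: ln_sqrt)
  then have "tanh (ln y / 2) = (y - 1) / (y + 1)"
    using y by (simp add: tanh_ln_real)
  also have "\<dots> = t" using assms by (simp add: y_def field_simps abs_less_iff)
  finally show ?thesis by (simp add: y_def)
qed

lemma tanh_shift_of:
  assumes "0 < \<omega>" "\<bar>t\<bar> < 1"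
  shows "tanh (sqrt \<omega> * shift_of \<omega> t) = t"
proof -
  have "sqrt \<omega> * shift_of \<omega> t = ln ((1 + t) / (1 - t)) / 2"
    using assms(1) by (simp add: shift_of_def)
  then show ?thesis by (simp only: tanh_half_ln[OF assms(2)])
qed

text \<open>
  With \<open>s = \<gamma> sqrt \<omega>\<close> and \<open>S = sqrt (1 + s\<^sup>2)\<close>, the inner root is \<open>T = sqrt ((S - 1) (S + 3))\<close>, and both
  bounds reduce to \<open>S - 1 < T < 2 s - (S - 1)\<close>. After squaring and dividing by \<open>S - 1\<close>,
  the left inequality says \<open>S - 1 < S + 3\<close> and the right one says \<open>s < S\<close>.
\<close>

lemma t1_t2_bounds:
  assumes "0 < \<gamma>" "0 < \<omega>"
  shows "\<bar>t1 \<gamma> \<omega>\<bar> < 1" "\<bar>t2 \<gamma> \<omega>\<bar> < 1"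
proof -
  define s where "s = \<gamma> * sqrt \<omega>"
  define S where "S = sqrt (1 + s\<^sup>2)"
  define T where "T = sqrt (s\<^sup>2 - 2 + 2 * S)"
  have s: "s > 0" using assms by (simp add: s_def)
  have s2: "\<gamma>\<^sup>2 * \<omega> = s\<^sup>2" using assms by (simp add: s_def power_mult_distrib)
  have S2: "S\<^sup>2 = 1 + s\<^sup>2" by (simp add: S_def)
  have S1: "1 < S" using s by (simp add: S_def)
  have sS: "s < S" using S2 S1 s by (intro power_less_imp_less_base[of s 2 S]) auto
  have "s\<^sup>2 - 2 + 2 * S = (S - 1) * (S + 3)" using S2 by (simp add: power2_eq_square algebra_simps)
  then have T2: "T\<^sup>2 = (S - 1) * (S + 3)" and T0: "0 \<le> T" using S1 by (simp_all add: T_def)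
  have TS: "S - 1 < T"
  proof (rule power_less_imp_less_base)
    have "(S - 1) * (S - 1) < (S - 1) * (S + 3)" using S1 by (intro mult_strict_left_mono) auto
    then show "(S - 1)\<^sup>2 < T\<^sup>2" unfolding T2 by (simp add: power2_eq_square)
  qed (rule T0)
  have "S - 1 < s"
  proof (rule power_less_imp_less_base)
    have "(S - 1) * (S - 1) < (S - 1) * (S + 1)" using S1 by (intro mult_strict_left_mono) auto
    then show "(S - 1)\<^sup>2 < s\<^sup>2" using S2 by (simp add: power2_eq_square algebra_simps)
  qed (use s in simp)
  moreover have "T < 2 * s - (S - 1)"
  proof (rule power_less_imp_less_base)
    have "4 * s * (S - 1) < 4 * S * (S - 1)"
      using sS S1 by (intro mult_strict_right_mono) auto
    then show "T\<^sup>2 < (2 * s - (S - 1))\<^sup>2"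
      using T2 S2 by (simp add: power2_eq_square algebra_simps)
  qed (use calculation s in simp)
  ultimately have num: "\<bar>1 - S + T\<bar> < 2 * s" "\<bar>S - 1 + T\<bar> < 2 * s"
    using TS S1 T0 by linarith+
  have t: "t1 \<gamma> \<omega> = (1 - S + T) / (2 * s)" "t2 \<gamma> \<omega> = (S - 1 + T) / (2 * s)"
    by (simp_all add: t1_def t2_def s2 S_def T_def s_def mult.assoc)
  show "\<bar>t1 \<gamma> \<omega>\<bar> < 1" "\<bar>t2 \<gamma> \<omega>\<bar> < 1"
    unfolding t abs_divide using num s by simp_all
qed

lemma amplitude_power2_div:
  assumes "0 < l" "0 < k"
  shows "(sqrt (2 / l) * k)\<^sup>2 / k = 2 / l * k"
proof -
  have "(sqrt (2 / l) * k)\<^sup>2 = 2 / l * (k * k)"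
    using assms by (simp add: power_mult_distrib) (simp add: power2_eq_square)
  then show ?thesis using assms by simp
qed

lemma mass_psi_even:
  assumes "0 < l" "0 < \<omega>"
  shows "L2_norm_sq UNIV (psi_even l \<omega>) = 4 * sqrt \<omega> / l"
  using assms unfolding psi_eq_two_solitons
  by (subst L2_norm_sq_two_solitons) (auto simp: power_mult_distrib field_simps simp flip: power2_eq_square)

text \<open>
  The two signs exchange and negate the shifts, so both choices give the same difference
  \<open>t2 - t1\<close>.
\<close>

lemma mass_psi_asym:
  assumes "0 < \<gamma>" "0 < l" "0 < \<omega>"
  shows "L2_norm_sq UNIV (psi_asym s \<gamma> l \<omega>) = 2 / l * (2 * sqrt \<omega> + (sqrt (1 + \<gamma>\<^sup>2 * \<omega>) - 1) / \<gamma>)"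
proof -
  have calc: "2 / l * m * (2 + X / (\<gamma> * m)) = 2 / l * (2 * m + X / \<gamma>)" if "0 < m" for m X
    using that assms by (simp add: field_simps)
  have "tanh (sqrt \<omega> * x2 s \<gamma> \<omega>) - tanh (sqrt \<omega> * x1 s \<gamma> \<omega>) = t2 \<gamma> \<omega> - t1 \<gamma> \<omega>"
    by (cases s) (simp_all add: tanh_shift_of t1_t2_bounds assms)
  also have "\<dots> = (sqrt (1 + \<gamma>\<^sup>2 * \<omega>) - 1) / (\<gamma> * sqrt \<omega>)"
    using assms by (simp add: t1_def t2_def field_simps)
  finally have t: "2 - tanh (sqrt \<omega> * x1 s \<gamma> \<omega>) + tanh (sqrt \<omega> * x2 s \<gamma> \<omega>) =
      2 + (sqrt (1 + \<gamma>\<^sup>2 * \<omega>) - 1) / (\<gamma> * sqrt \<omega>)" by simp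
  have "L2_norm_sq UNIV (psi_asym s \<gamma> l \<omega>) =
      (sqrt (2 / l) * sqrt \<omega>)\<^sup>2 / sqrt \<omega> * (2 + (sqrt (1 + \<gamma>\<^sup>2 * \<omega>) - 1) / (\<gamma> * sqrt \<omega>))"
    unfolding psi_eq_two_solitons t[symmetric] using assms by (intro L2_norm_sq_two_solitons) auto
  also have "(sqrt (2 / l) * sqrt \<omega>)\<^sup>2 / sqrt \<omega> = 2 / l * sqrt \<omega>"
    using assms by (intro amplitude_power2_div) auto
  also have "2 / l * sqrt \<omega> * (2 + (sqrt (1 + \<gamma>\<^sup>2 * \<omega>) - 1) / (\<gamma> * sqrt \<omega>)) =
      2 / l * (2 * sqrt \<omega> + (sqrt (1 + \<gamma>\<^sup>2 * \<omega>) - 1) / \<gamma>)"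
    using assms by (intro calc) simp
  finally show ?thesis .
qed

lemma xbar_eq:
  assumes "0 < \<gamma>" "4 / \<gamma>\<^sup>2 < \<omega>"
  shows "2 < \<gamma> * sqrt \<omega>" "sqrt \<omega> * xbar \<gamma> \<omega> = ln ((\<gamma> * sqrt \<omega> + 2) / (\<gamma> * sqrt \<omega> - 2)) / 2"
proof -
  have "0 < \<omega>" using assms by (auto intro: less_trans[rotated])
  then show "sqrt \<omega> * xbar \<gamma> \<omega> = ln ((\<gamma> * sqrt \<omega> + 2) / (\<gamma> * sqrt \<omega> - 2)) / 2"
    by (simp add: xbar_def)
  have "sqrt (4 / \<gamma>\<^sup>2) < sqrt \<omega>" using assms by simp
  then show "2 < \<gamma> * sqrt \<omega>" using assms by (simp add: real_sqrt_divide field_simps)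
qed

lemma mass_psi_odd:
  assumes "0 < \<gamma>" "0 < l" "4 / \<gamma>\<^sup>2 < \<omega>"
  shows "L2_norm_sq UNIV (psi_odd \<gamma> l \<omega>) = 4 / l * (sqrt \<omega> - 2 / \<gamma>)"
proof -
  have calc: "2 / l * m * (2 - 2 / (\<gamma> * m) + - (2 / (\<gamma> * m))) = 4 / l * (m - 2 / \<gamma>)" if "0 < m" for m
    using that assms(1,2) by (simp add: field_simps)
  note x = xbar_eq[OF assms(1,3)]
  have \<omega>: "0 < \<omega>" using assms by (auto intro: less_trans[rotated])
  let ?t = "2 / (\<gamma> * sqrt \<omega>)"
  have "(m + 2) / (m - 2) = (1 + 2 / m) / (1 - 2 / m)" if "2 < m" for m :: real
    using that by (simp add: field_simps)
  from this[OF x(1)] have "(\<gamma> * sqrt \<omega> + 2) / (\<gamma> * sqrt \<omega> - 2) = (1 + ?t) / (1 - ?t)" .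
  then have t: "tanh (sqrt \<omega> * xbar \<gamma> \<omega>) = ?t"
    using x assms(1) \<omega> by (simp only: x(2) tanh_half_ln) (simp add: tanh_half_ln)
  have "L2_norm_sq UNIV (psi_odd \<gamma> l \<omega>) = (sqrt (2 / l) * sqrt \<omega>)\<^sup>2 / sqrt \<omega> * (2 - ?t + - ?t)"
    unfolding psi_eq_two_solitons t[symmetric] tanh_minus[symmetric] mult_minus_right[symmetric]
    using \<omega> by (intro L2_norm_sq_two_solitons) auto
  also have "(sqrt (2 / l) * sqrt \<omega>)\<^sup>2 / sqrt \<omega> = 2 / l * sqrt \<omega>"
    using assms \<omega> by (intro amplitude_power2_div) auto
  also have "2 / l * sqrt \<omega> * (2 - ?t + - ?t) = 4 / l * (sqrt \<omega> - 2 / \<gamma>)"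
    using \<omega> by (intro calc) simp
  finally show ?thesis .
qed

section \<open>The members of mass \<open>\<rho>\<close>\<close>

lemma phi_even_eq:
  assumes "0 < l" "0 < \<rho>"
  shows "phi_even l \<rho> = psi_even l ((l * \<rho> / 4)\<^sup>2)"
  unfolding phi_even_def
proof (rule member_of_mass_eq)
  show "L2_norm_sq UNIV (psi_even l ((l * \<rho> / 4)\<^sup>2)) = \<rho>"
    using assms by (subst mass_psi_even) auto
  fix \<omega> assume "\<omega> \<in> {0<..}" "L2_norm_sq UNIV (psi_even l \<omega>) = \<rho>"
  then have "sqrt \<omega> = l * \<rho> / 4" "0 \<le> \<omega>"
    using assms by (auto simp: mass_psi_even field_simps)
  then show "\<omega> = (l * \<rho> / 4)\<^sup>2" by (metis real_sqrt_pow2)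
qed (use assms in simp)

lemma phi_odd_eq:
  assumes "0 < \<gamma>" "0 < l" "0 < \<rho>"
  shows "phi_odd \<gamma> l \<rho> = psi_odd \<gamma> l ((2 / \<gamma> + l * \<rho> / 4)\<^sup>2)" (is "_ = psi_odd \<gamma> l ?\<omega>")
    and "4 / \<gamma>\<^sup>2 < (2 / \<gamma> + l * \<rho> / 4)\<^sup>2"
proof -
  have "(2 / \<gamma>)\<^sup>2 < ?\<omega>" using assms by (intro power_strict_mono) auto
  then show I: "4 / \<gamma>\<^sup>2 < ?\<omega>" by (simp add: power_divide)
  show "phi_odd \<gamma> l \<rho> = psi_odd \<gamma> l ?\<omega>"
    unfolding phi_odd_def
  proof (rule member_of_mass_eq)
    show "L2_norm_sq UNIV (psi_odd \<gamma> l ?\<omega>) = \<rho>"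
      using assms I by (subst mass_psi_odd) (auto simp: real_sqrt_abs add_nonneg_nonneg)
    fix \<omega> assume \<omega>: "\<omega> \<in> {4 / \<gamma>\<^sup>2<..}" "L2_norm_sq UNIV (psi_odd \<gamma> l \<omega>) = \<rho>"
    then have "4 / l * (sqrt \<omega> - 2 / \<gamma>) = \<rho>"
      using assms by (simp add: mass_psi_odd)
    then have "sqrt \<omega> = 2 / \<gamma> + l * \<rho> / 4"
      using assms by (simp add: field_simps)
    moreover have "0 \<le> \<omega>"
      using \<omega>(1) assms by (auto intro: order_trans[rotated] less_imp_le)
    ultimately show "\<omega> = ?\<omega>" by (metis real_sqrt_pow2)
  qed (use I in simp)
qed

text \<open>
  The mass is a strictly increasing continuous function of the frequency, it vanishes at \<open>0\<close>, and its first
  summand alone reaches \<open>\<rho>\<close> when \<open>sqrt \<omega> = l \<rho> / 4\<close>. The intermediate value theorem gives the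
  frequency together with the bound on it.
\<close>

lemma phi_asym_eq:
  assumes "0 < \<gamma>" "0 < l" "0 < \<rho>"
  obtains \<omega> where "0 < \<omega>" "sqrt \<omega> \<le> \<rho> / 4 * l" "phi_asym s \<gamma> l \<rho> = psi_asym s \<gamma> l \<omega>"
    "L2_norm_sq UNIV (psi_asym s \<gamma> l \<omega>) = \<rho>"
proof -
  define m where "m \<omega> = 2 / l * (2 * sqrt \<omega> + (sqrt (1 + \<gamma>\<^sup>2 * \<omega>) - 1) / \<gamma>)" for \<omega>
  have mono: "m \<omega> < m \<omega>'" if "\<omega> < \<omega>'" for \<omega> \<omega>'
    using that assms unfolding m_def
    by (intro mult_strict_left_mono add_strict_mono divide_strict_right_mono diff_strict_right_mono) auto
  have "continuous_on {0..(\<rho> / 4 * l)\<^sup>2} m"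
    unfolding m_def using assms by (intro continuous_intros) auto
  moreover have "\<rho> \<le> m ((\<rho> / 4 * l)\<^sup>2)"
  proof -
    have "\<rho> = 2 / l * (2 * sqrt ((\<rho> / 4 * l)\<^sup>2) + 0)" using assms by simp
    also have "\<dots> \<le> m ((\<rho> / 4 * l)\<^sup>2)"
      unfolding m_def using assms by (intro mult_left_mono add_left_mono divide_nonneg_pos) auto
    finally show ?thesis .
  qed
  moreover have m0: "m 0 = 0" by (simp add: m_def)
  ultimately obtain \<omega> where \<omega>: "0 \<le> \<omega>" "\<omega> \<le> (\<rho> / 4 * l)\<^sup>2" "m \<omega> = \<rho>"
    using IVT'[of m 0 \<rho> "(\<rho> / 4 * l)\<^sup>2"] assms by auto
  have pos: "0 < \<omega>" using \<omega> m0 assms by (cases "\<omega> = 0") auto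
  have mass: "L2_norm_sq UNIV (psi_asym s \<gamma> l \<omega>') = m \<omega>'" if "0 < \<omega>'" for \<omega>'
    using that assms by (simp add: mass_psi_asym m_def)
  show ?thesis
  proof (rule that[OF pos])
    show "sqrt \<omega> \<le> \<rho> / 4 * l" using \<omega>(2) assms by (intro real_le_lsqrt) auto
    show *: "L2_norm_sq UNIV (psi_asym s \<gamma> l \<omega>) = \<rho>" using pos \<omega>(3) by (simp add: mass)
    show "phi_asym s \<gamma> l \<rho> = psi_asym s \<gamma> l \<omega>"
      unfolding phi_asym_def
    proof (rule member_of_mass_eq[where psi = "psi_asym s \<gamma> l"])
      show "L2_norm_sq UNIV (psi_asym s \<gamma> l \<omega>) = \<rho>" by (rule *)
      fix \<omega>' assume "\<omega>' \<in> {0<..}" "L2_norm_sq UNIV (psi_asym s \<gamma> l \<omega>') = \<rho>"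
      then have "m \<omega>' = m \<omega>" using \<omega>(3) mass by simp
      then show "\<omega>' = \<omega>" using mono[of \<omega> \<omega>'] mono[of \<omega>' \<omega>] by (cases \<omega>' \<omega> rule: linorder_cases) auto
    qed (use pos in simp)
  qed
qed

section \<open>The tail of a soliton\<close>

text \<open>
  Up to the amplitude, \<open>soliton_tail\<close> is \<open>sech (k (y + z))\<close> with numerator and denominator multiplied by
  \<open>exp (- k (y + z))\<close>, where \<open>r = exp (- 2 k z)\<close>. In contrast to the shift \<open>z\<close>, the coefficient \<open>r\<close> has a
  finite limit as the shift escapes to infinity: \<open>r = 0\<close> is the pure exponential.
\<close>

definition soliton_tail :: "real \<Rightarrow> real \<Rightarrow> real \<Rightarrow> real \<Rightarrow> real" where
  "soliton_tail a k r y = a * exp (- k * y) / (1 + r * exp (- 2 * k * y))"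

definition soliton_tail_deriv :: "real \<Rightarrow> real \<Rightarrow> real \<Rightarrow> real \<Rightarrow> real" where
  "soliton_tail_deriv a k r y = - k * soliton_tail a k r y * ((1 - r * exp (- 2 * k * y)) / (1 + r * exp (- 2 * k * y)))"

lemma soliton_tail_denominator_pos: "0 \<le> r \<Longrightarrow> 0 < 1 + r * exp (y::real)"
  by (intro add_pos_nonneg) auto

lemma soliton_tail_has_derivative:
  assumes "0 \<le> r"
  shows "(soliton_tail a k r has_real_derivative soliton_tail_deriv a k r y) (at y)"
proof -
  have "1 + r * exp (- 2 * k * y) \<noteq> 0"
    using soliton_tail_denominator_pos[OF assms, of "- 2 * k * y"] by linarith
  then show ?thesis
    unfolding soliton_tail_def [abs_def] soliton_tail_deriv_def
    by (auto intro!: derivative_eq_intros simp: field_simps) (subst minus_divide_left, simp)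
qed

lemma continuous_on_soliton_tail_deriv:
  assumes "0 \<le> r"
  shows "continuous_on S (soliton_tail_deriv a k r)"
proof -
  have "1 + r * exp (- 2 * k * y) \<noteq> 0" for y
    using soliton_tail_denominator_pos[OF assms, of "- 2 * k * y"] by linarith
  then show ?thesis
    unfolding soliton_tail_def [abs_def] soliton_tail_deriv_def [abs_def] by (intro continuous_intros) auto
qed

lemma soliton_tail_bounds:
  assumes "0 \<le> r" "0 < k"
  shows "\<bar>soliton_tail a k r y\<bar> \<le> \<bar>a\<bar> * exp (- k * y)" "\<bar>soliton_tail_deriv a k r y\<bar> \<le> k * \<bar>a\<bar> * exp (- k * y)"
proof -
  define e where "e = r * exp (- 2 * k * y)"
  have e: "0 \<le> e" using assms by (simp add: e_def)
  have "\<bar>soliton_tail a k r y\<bar> = \<bar>a\<bar> * exp (- k * y) / (1 + e)"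
    unfolding soliton_tail_def e_def[symmetric] using e by (simp add: abs_mult)
  also have "\<dots> \<le> \<bar>a\<bar> * exp (- k * y) / 1"
    using e by (intro divide_left_mono) auto
  finally show 1: "\<bar>soliton_tail a k r y\<bar> \<le> \<bar>a\<bar> * exp (- k * y)" by simp
  have "\<bar>(1 - e) / (1 + e)\<bar> \<le> 1" using e by (simp add: abs_le_iff field_simps)
  then have "k * \<bar>soliton_tail a k r y\<bar> * \<bar>(1 - e) / (1 + e)\<bar> \<le> k * (\<bar>a\<bar> * exp (- k * y)) * 1"
    using 1 assms by (intro mult_mono) auto
  then show "\<bar>soliton_tail_deriv a k r y\<bar> \<le> k * \<bar>a\<bar> * exp (- k * y)"
    unfolding soliton_tail_deriv_def e_def[symmetric] using assms by (simp add: abs_mult mult_ac)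
qed

text \<open>
  On the half line of sign \<open>\<sigma>\<close> the function agrees with \<open>\<sigma> f (\<sigma> x)\<close>, which is as smooth on the whole line as
  \<open>f\<close>.
\<close>

lemma H1_dominated_odd:
  fixes f f' :: "real \<Rightarrow> real"
  assumes f: "\<And>y. (f has_real_derivative f' y) (at y)" and f': "continuous_on UNIV f'"
    and u: "\<And>x. x \<noteq> 0 \<Longrightarrow> u x = of_real (sgn x * f \<bar>x\<bar>)"
  shows "H1_dominated u (\<lambda>x. \<bar>f \<bar>x\<bar>\<bar> + \<bar>f' \<bar>x\<bar>\<bar>)"
proof -
  have C1: "\<exists>U U'. (\<forall>x. (U has_vector_derivative U' x) (at x)) \<and> continuous_on UNIV U' \<and>
     (\<forall>x\<in>S. u x = U x \<and> cmod (U x) \<le> \<bar>f \<bar>x\<bar>\<bar> + \<bar>f' \<bar>x\<bar>\<bar> \<and> cmod (U' x) \<le> \<bar>f \<bar>x\<bar>\<bar> + \<bar>f' \<bar>x\<bar>\<bar>)"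
    if S: "\<And>x. x \<in> S \<Longrightarrow> \<bar>x\<bar> = \<sigma> * x \<and> sgn x = \<sigma> \<and> x \<noteq> 0" and \<sigma>: "\<sigma> * \<sigma> = 1" for S \<sigma>
  proof -
    let ?U = "\<lambda>x. complex_of_real (\<sigma> * f (\<sigma> * x))" and ?U' = "\<lambda>x. complex_of_real (f' (\<sigma> * x))"
    have D: "\<forall>x. (?U has_vector_derivative ?U' x) (at x)"
    proof
      fix x
      have "((\<lambda>x. f (\<sigma> * x)) has_real_derivative f' (\<sigma> * x) * \<sigma>) (at x)"
        by (rule DERIV_chain2[OF f]) (auto intro!: derivative_eq_intros)
      then have "((\<lambda>x. \<sigma> * f (\<sigma> * x)) has_real_derivative \<sigma> * (f' (\<sigma> * x) * \<sigma>)) (at x)"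
        by (rule DERIV_cmult)
      also have "\<sigma> * (f' (\<sigma> * x) * \<sigma>) = f' (\<sigma> * x)" using \<sigma> by (simp add: mult_ac)
      finally show "(?U has_vector_derivative ?U' x) (at x)" by (rule has_vector_derivative_of_real)
    qed
    have cont: "continuous_on UNIV ?U'"
      by (intro continuous_intros continuous_on_compose2[OF f']) auto
    have "\<forall>x\<in>S. u x = ?U x \<and> cmod (?U x) \<le> \<bar>f \<bar>x\<bar>\<bar> + \<bar>f' \<bar>x\<bar>\<bar> \<and> cmod (?U' x) \<le> \<bar>f \<bar>x\<bar>\<bar> + \<bar>f' \<bar>x\<bar>\<bar>"
    proof
      fix x assume "x \<in> S"
      note x = S[OF this]
      have "\<bar>\<sigma>\<bar> = 1" using x by (metis abs_sgn_eq)
      then show "u x = ?U x \<and> cmod (?U x) \<le> \<bar>f \<bar>x\<bar>\<bar> + \<bar>f' \<bar>x\<bar>\<bar> \<and> cmod (?U' x) \<le> \<bar>f \<bar>x\<bar>\<bar> + \<bar>f' \<bar>x\<bar>\<bar>"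
        using x u[of x] by (simp only: norm_of_real) (simp add: abs_mult)
    qed
    with D cont show ?thesis by (intro exI conjI)
  qed
  show ?thesis
    unfolding H1_dominated_def
  proof
    fix S :: "real set" assume "S \<in> {{0<..}, {..<0}}"
    then consider "S = {0<..}" | "S = {..<0}" by blast
    then show "\<exists>U U'. (\<forall>x. (U has_vector_derivative U' x) (at x)) \<and> continuous_on UNIV U' \<and>
     (\<forall>x\<in>S. u x = U x \<and> cmod (U x) \<le> \<bar>f \<bar>x\<bar>\<bar> + \<bar>f' \<bar>x\<bar>\<bar> \<and> cmod (U' x) \<le> \<bar>f \<bar>x\<bar>\<bar> + \<bar>f' \<bar>x\<bar>\<bar>)"
    proof cases
      case 1 then show ?thesis by (intro C1[of _ 1]) auto
    next
      case 2 then show ?thesis by (intro C1[of _ "-1"]) auto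
    qed
  qed
qed

text \<open>
  This bounds the tails by a hyperbolic secant, whose integrability is already known.
\<close>

lemma exp_minus_abs_le_sech: "exp (- \<bar>x\<bar>) \<le> sech x"
proof -
  have "cosh x \<le> exp \<bar>x\<bar>"
    by (auto simp: cosh_def abs_if)
  then have "1 / exp \<bar>x\<bar> \<le> 1 / cosh x"
    using cosh_real_ge_1[of x] by (intro divide_left_mono) auto
  then show ?thesis by (simp add: exp_minus inverse_eq_divide sech_def)
qed

text \<open>
  This sum of the distances of the profile and of its derivative from the pure exponential is the bound that
  \<open>H1_dominated\<close> asks for, for the odd extension of the difference.
\<close>

definition soliton_tail_dist :: "real \<Rightarrow> real \<Rightarrow> real \<Rightarrow> real \<Rightarrow> real \<Rightarrow> real \<Rightarrow> real" where
  "soliton_tail_dist c \<kappa> a k r x = \<bar>soliton_tail a k r \<bar>x\<bar> - soliton_tail c \<kappa> 0 \<bar>x\<bar>\<bar> + \<bar>soliton_tail_deriv a k r \<bar>x\<bar> - soliton_tail_deriv c \<kappa> 0 \<bar>x\<bar>\<bar>"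

lemma soliton_tail_dist_nonneg: "0 \<le> soliton_tail_dist c \<kappa> a k r x"
  by (simp add: soliton_tail_dist_def)

text \<open>
  The bound depends on \<open>a\<close> and \<open>k\<close> only through a constant factor, since \<open>k \<ge> \<kappa>\<close>; so it serves as a common
  majorant in dominated convergence.
\<close>

lemma soliton_tail_dist_le:
  assumes "0 < \<kappa>" "\<kappa> \<le> k" "0 \<le> r"
  shows "soliton_tail_dist c \<kappa> a k r x \<le> (\<bar>a\<bar> + \<bar>c\<bar> + (k * \<bar>a\<bar> + \<kappa> * \<bar>c\<bar>)) * sech (\<kappa> * x)"
proof -
  let ?e = "exp (- \<kappa> * \<bar>x\<bar>)"
  have k: "0 < k" using assms by linarith
  have "\<kappa> * \<bar>x\<bar> \<le> k * \<bar>x\<bar>" using assms by (intro mult_right_mono) auto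
  then have e: "exp (- k * \<bar>x\<bar>) \<le> ?e" by simp
  have "soliton_tail_dist c \<kappa> a k r x \<le> (\<bar>a\<bar> * exp (- k * \<bar>x\<bar>) + \<bar>c\<bar> * ?e) + (k * \<bar>a\<bar> * exp (- k * \<bar>x\<bar>) + \<kappa> * \<bar>c\<bar> * ?e)"
    unfolding soliton_tail_dist_def
    by (intro add_mono order_trans[OF abs_triangle_ineq4] soliton_tail_bounds assms k order_refl)
  also have "\<dots> \<le> (\<bar>a\<bar> * ?e + \<bar>c\<bar> * ?e) + (k * \<bar>a\<bar> * ?e + \<kappa> * \<bar>c\<bar> * ?e)"
    using k e by (intro add_mono mult_left_mono order_refl) auto
  also have "\<dots> = (\<bar>a\<bar> + \<bar>c\<bar> + (k * \<bar>a\<bar> + \<kappa> * \<bar>c\<bar>)) * exp (- \<bar>\<kappa> * x\<bar>)"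
    using assms(1) by (simp add: abs_mult algebra_simps)
  also have "\<dots> \<le> (\<bar>a\<bar> + \<bar>c\<bar> + (k * \<bar>a\<bar> + \<kappa> * \<bar>c\<bar>)) * sech (\<kappa> * x)"
    using assms(1) k by (intro mult_left_mono exp_minus_abs_le_sech) auto
  finally show ?thesis .
qed

lemma integrable_sech_power2:
  assumes "0 < \<kappa>" "0 \<le> B"
  shows "integrable lborel (\<lambda>x. (B * sech (\<kappa> * x))\<^sup>2)"
proof (rule integrable_power2_bounded)
  show "integrable lborel (\<lambda>x. B * sech (\<kappa> * x))"
    using integrable_sech[OF assms(1), of 0] by simp
  show "0 \<le> B * sech (\<kappa> * x)" for x
    using sech_bounds(1)[of "\<kappa> * x"] assms(2) by simp
  show "B * sech (\<kappa> * x) \<le> B" for x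
    using mult_left_mono[OF sech_bounds(2) assms(2)] by simp
qed

lemma soliton_tail_dist_measurable: "(\<lambda>x. (soliton_tail_dist c \<kappa> a k r x)\<^sup>2) \<in> borel_measurable lborel"
  unfolding soliton_tail_dist_def soliton_tail_deriv_def soliton_tail_def by measurable

lemma integrable_soliton_tail_dist_power2:
  assumes "0 < \<kappa>" "\<kappa> \<le> k" "0 \<le> r"
  shows "integrable lborel (\<lambda>x. (soliton_tail_dist c \<kappa> a k r x)\<^sup>2)"
proof (rule Bochner_Integration.integrable_bound[OF integrable_sech_power2 soliton_tail_dist_measurable])
  show "AE x in lborel. norm ((soliton_tail_dist c \<kappa> a k r x)\<^sup>2)
      \<le> norm (((\<bar>a\<bar> + \<bar>c\<bar> + (k * \<bar>a\<bar> + \<kappa> * \<bar>c\<bar>)) * sech (\<kappa> * x))\<^sup>2)"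
    using power_mono[OF soliton_tail_dist_le[OF assms] soliton_tail_dist_nonneg, of _ _ _ 2] by (intro AE_I2) simp
qed (use assms in auto)

lemma integral_soliton_tail_dist_tendsto_0:
  assumes a: "a \<longlonglongrightarrow> c" and k: "k \<longlonglongrightarrow> \<kappa>" "\<And>n. \<kappa> \<le> k n" "0 < \<kappa>"
    and r: "r \<longlonglongrightarrow> 0" "\<And>n. 0 \<le> r n"
  shows "(\<lambda>n. LINT x|lborel. (soliton_tail_dist c \<kappa> (a n) (k n) (r n) x)\<^sup>2) \<longlonglongrightarrow> 0"
proof -
  obtain A where A: "\<And>n. \<bar>a n\<bar> \<le> A"
    using convergent_imp_Bseq[OF convergentI[OF a]] by (auto simp: Bseq_def)
  obtain K where K: "\<And>n. \<bar>k n\<bar> \<le> K"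
    using convergent_imp_Bseq[OF convergentI[OF k(1)]] by (auto simp: Bseq_def)
  define B where "B = A + \<bar>c\<bar> + (K * A + \<kappa> * \<bar>c\<bar>)"
  have B0: "0 \<le> B"
    using A[of 0] K[of 0] k(3) unfolding B_def by (intro add_nonneg_nonneg mult_nonneg_nonneg) auto
  have le: "soliton_tail_dist c \<kappa> (a n) (k n) (r n) x \<le> B * sech (\<kappa> * x)" for n x
  proof -
    have "\<bar>a n\<bar> + \<bar>c\<bar> + (k n * \<bar>a n\<bar> + \<kappa> * \<bar>c\<bar>) \<le> B"
      using A[of n] K[of n] k(2)[of n] k(3) unfolding B_def by (intro add_mono mult_mono order_refl) auto
    then show ?thesis
      using sech_bounds(1)[of "\<kappa> * x"]
      by (intro order_trans[OF soliton_tail_dist_le[OF k(3) k(2)[of n] r(2)[of n], of c "a n" x]] mult_right_mono) auto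
  qed
  have "(\<lambda>n. LINT x|lborel. (soliton_tail_dist c \<kappa> (a n) (k n) (r n) x)\<^sup>2) \<longlonglongrightarrow> integral\<^sup>L (lborel :: real measure) (\<lambda>x. 0)"
  proof (rule integral_dominated_convergence[where w = "\<lambda>x. (B * sech (\<kappa> * x))\<^sup>2"])
    show "AE x in lborel. (\<lambda>n. (soliton_tail_dist c \<kappa> (a n) (k n) (r n) x)\<^sup>2) \<longlonglongrightarrow> 0"
    proof (rule AE_I2)
      fix x
      have t: "(\<lambda>n. soliton_tail (a n) (k n) (r n) \<bar>x\<bar>) \<longlonglongrightarrow> soliton_tail c \<kappa> 0 \<bar>x\<bar>"
        unfolding soliton_tail_def by (intro tendsto_intros a k r) simp
      have "(\<lambda>n. soliton_tail_deriv (a n) (k n) (r n) \<bar>x\<bar>) \<longlonglongrightarrow> soliton_tail_deriv c \<kappa> 0 \<bar>x\<bar>"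
        unfolding soliton_tail_deriv_def by (intro tendsto_intros a k r t) simp
      with t have "(\<lambda>n. (soliton_tail_dist c \<kappa> (a n) (k n) (r n) x)\<^sup>2) \<longlonglongrightarrow> (\<bar>soliton_tail c \<kappa> 0 \<bar>x\<bar> - soliton_tail c \<kappa> 0 \<bar>x\<bar>\<bar>
         + \<bar>soliton_tail_deriv c \<kappa> 0 \<bar>x\<bar> - soliton_tail_deriv c \<kappa> 0 \<bar>x\<bar>\<bar>)\<^sup>2"
        unfolding soliton_tail_dist_def by (intro tendsto_intros)
      then show "(\<lambda>n. (soliton_tail_dist c \<kappa> (a n) (k n) (r n) x)\<^sup>2) \<longlonglongrightarrow> 0" by simp
    qed
    show "AE x in lborel. norm ((soliton_tail_dist c \<kappa> (a n) (k n) (r n) x)\<^sup>2) \<le> (B * sech (\<kappa> * x))\<^sup>2" for n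
      using power_mono[OF le soliton_tail_dist_nonneg, of n _ 2] by (intro AE_I2) simp
    show "integrable lborel (\<lambda>x. (B * sech (\<kappa> * x))\<^sup>2)"
      by (rule integrable_sech_power2[OF k(3) B0])
  qed (rule soliton_tail_dist_measurable | simp)+
  then show ?thesis by simp
qed

text \<open>
  Here \<open>\<gamma> k - 2\<close> and \<open>\<gamma> k + 2\<close> equal \<open>\<gamma> \<rho> l / 4\<close> and \<open>4 + \<gamma> \<rho> l / 4\<close>, and \<open>r\<close> is their quotient. It
  carries a factor \<open>l\<close>, which cancels the \<open>1 / l\<close> under the square root in the amplitude, so that the
  coefficient \<open>a\<close> has a finite limit.
\<close>

lemma phi_odd_eq_soliton_tail:
  assumes "0 < \<gamma>" "0 < l" "0 < \<rho>"
  defines "k \<equiv> 2 / \<gamma> + l * \<rho> / 4"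
    and "r \<equiv> \<gamma> * \<rho> / 4 * l / (4 + \<gamma> * \<rho> / 4 * l)"
    and "a \<equiv> 2 * (2 / \<gamma> + l * \<rho> / 4) * sqrt (2 * (\<gamma> * \<rho> / 4) / (4 + \<gamma> * \<rho> / 4 * l))"
  assumes "x \<noteq> 0"
  shows "phi_odd \<gamma> l \<rho> x = of_real (sgn x * soliton_tail a k r \<bar>x\<bar>)"
proof -
  have k0: "0 < k" using assms by (simp add: k_def add_pos_pos)
  then have sq: "sqrt (k\<^sup>2) = k" by simp
  have gk: "\<gamma> * k - 2 = \<gamma> * \<rho> / 4 * l" "\<gamma> * k + 2 = 4 + \<gamma> * \<rho> / 4 * l"
    using assms(1) by (simp_all add: k_def field_simps)
  have r: "0 < r" using assms by (simp add: r_def add_pos_pos)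
  define z where "z = xbar \<gamma> (k\<^sup>2)"
  have "k * z = ln (1 / r) / 2"
    using xbar_eq(2)[OF assms(1) phi_odd_eq(2)[OF assms(1-3)], folded k_def] unfolding z_def sq gk
    by (simp add: r_def)
  then have kz: "2 * (k * z) = - ln r" using r by (simp add: ln_div)
  have e: "exp (- (k * z)) = sqrt r"
  proof -
    have "exp (- (k * z)) = exp (ln r / 2)" using kz by simp
    also have "\<dots> = sqrt r" using r by (simp flip: ln_sqrt)
    finally show ?thesis .
  qed
  have sech: "sech y = 2 * exp (- y) / (1 + exp (- y) * exp (- y))" for y
  proof -
    have "1 / cosh y = 2 * exp (- y) / (exp (- y) * (exp y + exp (- y)))"
      by (simp add: cosh_def)
    then show ?thesis by (simp add: sech_def distrib_left flip: exp_add)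
  qed
  have "sqrt (2 / l) * k * sech (k * (y + z)) = soliton_tail a k r y" for y
  proof -
    have ex: "exp (- (k * (y + z))) = sqrt r * exp (- k * y)"
      unfolding e[symmetric] by (simp add: algebra_simps flip: exp_add)
    have ex2: "exp (- (k * (y + z))) * exp (- (k * (y + z))) = r * exp (- 2 * k * y)"
      unfolding ex using r by (simp add: algebra_simps flip: exp_add)
    have "sqrt (2 / l) * k * (2 * sqrt r) = a"
    proof -
      have "sqrt (2 / l) * sqrt r = sqrt (2 * (\<gamma> * \<rho> / 4) / (4 + \<gamma> * \<rho> / 4 * l))"
        using assms(2) by (simp add: r_def field_simps flip: real_sqrt_mult)
      note eq = this
      show ?thesis unfolding a_def k_def[symmetric] eq[symmetric] by simp
    qed
    then show ?thesis
      unfolding sech ex2 unfolding ex soliton_tail_def by (simp add: mult_ac)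
  qed
  note this[of "\<bar>x\<bar>"]
  moreover have "sech (- y) = sech y" for y by (simp add: sech_def)
  from this[of "k * (x - z)"] have "sech (k * (x - z)) = sech (k * (- x + z))"
    by (simp add: algebra_simps)
  moreover have "phi_odd \<gamma> l \<rho> = two_solitons (- 1) (sqrt (2 / l) * k) k z (- z)"
    using phi_odd_eq(1)[OF assms(1-3), folded k_def] psi_eq_two_solitons(3)[of \<gamma> l "k\<^sup>2"]
    unfolding sq z_def by simp
  ultimately show ?thesis
    using assms(7) by (cases "x < 0") (simp_all add: two_solitons_def del: of_real_mult)
qed

section \<open>The limits\<close>

text \<open>
  By the explicit form of the odd profiles as soliton tails, it is enough that the three coefficients \<open>a\<close>, \<open>k\<close>
  and \<open>r\<close> converge to those of the limit, which is the soliton tail with \<open>r = 0\<close>.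
\<close>

lemma limitin_phi_odd:
  assumes "0 < \<gamma>" "0 < \<rho>"
  shows "limitin Q_strong_topology (\<lambda>l. phi_odd \<gamma> l \<rho>)
           (\<lambda>x. of_real (sgn x * sqrt (2 * \<rho> / \<gamma>) * exp (- (2 / \<gamma>) * \<bar>x\<bar>))) (at_right 0)"
    (is "limitin _ _ ?E _")
proof (rule limitin_Q_strong_topologyI)
  define \<kappa> where "\<kappa> = 2 / \<gamma>"
  define c where "c = sqrt (2 * \<rho> / \<gamma>)"
  define k where "k l = 2 / \<gamma> + l * \<rho> / 4" for l
  define r where "r l = \<gamma> * \<rho> / 4 * l / (4 + \<gamma> * \<rho> / 4 * l)" for l
  define a where "a l = 2 * (2 / \<gamma> + l * \<rho> / 4) * sqrt (2 * (\<gamma> * \<rho> / 4) / (4 + \<gamma> * \<rho> / 4 * l))" for l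
  define h where "h l = soliton_tail_dist c \<kappa> (a l) (k l) (r l)" for l
  have \<kappa>: "0 < \<kappa>" using assms by (simp add: \<kappa>_def)
  have E: "?E x = of_real (sgn x * soliton_tail c \<kappa> 0 \<bar>x\<bar>)" for x
    by (simp add: soliton_tail_def c_def \<kappa>_def)
  show EQ: "?E \<in> Q_space"
  proof (rule Q_space_if_H1_dominated)
    show "H1_dominated ?E (\<lambda>x. (\<bar>c\<bar> + \<kappa> * \<bar>c\<bar>) * sech (\<kappa> * x))"
    proof (rule H1_dominated_mono)
      show "H1_dominated ?E (\<lambda>x. \<bar>soliton_tail c \<kappa> 0 \<bar>x\<bar>\<bar> + \<bar>soliton_tail_deriv c \<kappa> 0 \<bar>x\<bar>\<bar>)"
        by (rule H1_dominated_odd[OF soliton_tail_has_derivative continuous_on_soliton_tail_deriv E]) auto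
      show "\<bar>soliton_tail c \<kappa> 0 \<bar>x\<bar>\<bar> + \<bar>soliton_tail_deriv c \<kappa> 0 \<bar>x\<bar>\<bar> \<le> (\<bar>c\<bar> + \<kappa> * \<bar>c\<bar>) * sech (\<kappa> * x)" for x
      proof -
        have "\<bar>soliton_tail c \<kappa> 0 \<bar>x\<bar>\<bar> + \<bar>soliton_tail_deriv c \<kappa> 0 \<bar>x\<bar>\<bar> \<le> \<bar>c\<bar> * exp (- \<kappa> * \<bar>x\<bar>) + \<kappa> * \<bar>c\<bar> * exp (- \<kappa> * \<bar>x\<bar>)"
          by (intro add_mono soliton_tail_bounds \<kappa>) auto
        also have "\<dots> = (\<bar>c\<bar> + \<kappa> * \<bar>c\<bar>) * exp (- \<bar>\<kappa> * x\<bar>)"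
          using \<kappa> by (simp add: distrib_right abs_mult)
        also have "\<dots> \<le> (\<bar>c\<bar> + \<kappa> * \<bar>c\<bar>) * sech (\<kappa> * x)"
          using \<kappa> by (intro mult_left_mono exp_minus_abs_le_sech) auto
        finally show ?thesis .
      qed
    qed
    show "integrable lborel (\<lambda>x. ((\<bar>c\<bar> + \<kappa> * \<bar>c\<bar>) * sech (\<kappa> * x))\<^sup>2)"
      using \<kappa> by (intro integrable_sech_power2) auto
  qed
  have dom: "H1_dominated (\<lambda>x. phi_odd \<gamma> l \<rho> x - ?E x) (h l)" if l: "0 < l" for l
  proof -
    have r: "0 \<le> r l" using l assms by (simp add: r_def)
    show ?thesis
      unfolding h_def soliton_tail_dist_def [abs_def]
    proof (rule H1_dominated_odd)
      show "((\<lambda>y. soliton_tail (a l) (k l) (r l) y - soliton_tail c \<kappa> 0 y) has_real_derivative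
          soliton_tail_deriv (a l) (k l) (r l) y - soliton_tail_deriv c \<kappa> 0 y) (at y)" for y
        by (intro DERIV_diff soliton_tail_has_derivative r) simp
      show "continuous_on UNIV (\<lambda>y. soliton_tail_deriv (a l) (k l) (r l) y - soliton_tail_deriv c \<kappa> 0 y)"
        by (intro continuous_on_diff continuous_on_soliton_tail_deriv r) simp
      show "phi_odd \<gamma> l \<rho> x - ?E x = of_real (sgn x * (soliton_tail (a l) (k l) (r l) \<bar>x\<bar> - soliton_tail c \<kappa> 0 \<bar>x\<bar>))"
        if "x \<noteq> 0" for x
        unfolding E phi_odd_eq_soliton_tail[OF assms(1) l assms(2) that, folded k_def r_def a_def]
        by (simp add: right_diff_distrib)
    qed
  qed
  show "\<forall>\<^sub>F l in at_right 0. phi_odd \<gamma> l \<rho> \<in> Q_space"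
    using eventually_at_right_less[of 0]
  proof eventually_elim
    case (elim l)
    let ?k = "2 / \<gamma> + l * \<rho> / 4"
    have k: "0 < ?k" using assms elim by (simp add: add_pos_pos)
    let ?u = "two_solitons (- 1) (sqrt (2 / l) * sqrt (?k\<^sup>2)) ?k (xbar \<gamma> (?k\<^sup>2)) (- xbar \<gamma> (?k\<^sup>2))"
    have eq: "phi_odd \<gamma> l \<rho> = ?u"
      using phi_odd_eq(1)[OF assms(1) elim assms(2)] psi_eq_two_solitons(3)[of \<gamma> l "?k\<^sup>2"] k by simp
    show ?case
      unfolding eq
    proof (rule Q_space_if_H1_dominated[OF H1_dominated_two_solitons[OF k]])
      show "integrable lborel (\<lambda>x. (max 1 ?k * cmod (?u x))\<^sup>2)"
      proof (rule integrable_power2_bounded)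
        show "integrable lborel (\<lambda>x. max 1 ?k * cmod (?u x))"
          by (intro integrable_mult_right integrable_cmod_two_solitons k) simp
        show "max 1 ?k * cmod (?u x) \<le> max 1 ?k * (\<bar>sqrt (2 / l) * sqrt (?k\<^sup>2)\<bar> * 1)" for x
          by (subst cmod_two_solitons) (auto intro!: mult_left_mono sech_bounds simp del: mult_1_right)
      qed auto
    qed simp
  qed
  have k_ge: "\<kappa> \<le> k l" and r_ge: "0 \<le> r l" if "0 < l" for l
    using that assms by (simp_all add: \<kappa>_def k_def r_def)
  have int_h: "integrable lborel (\<lambda>x. (h l x)\<^sup>2)" if "0 < l" for l
    unfolding h_def by (rule integrable_soliton_tail_dist_power2[OF \<kappa> k_ge[OF that] r_ge[OF that]])
  have lim_h: "((\<lambda>l. LINT x|lborel. (h l x)\<^sup>2) \<longlongrightarrow> 0) (at_right 0)"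
  proof (rule tendsto_at_right_sequentially[of 0 1])
    fix l :: "nat \<Rightarrow> real" assume l: "\<And>n. 0 < l n" "l \<longlonglongrightarrow> 0"
    show "(\<lambda>n. LINT x|lborel. (h (l n) x)\<^sup>2) \<longlonglongrightarrow> 0"
      unfolding h_def
    proof (rule integral_soliton_tail_dist_tendsto_0)
      have "c = 2 * (2 / \<gamma> + 0 * \<rho> / 4) * sqrt (2 * (\<gamma> * \<rho> / 4) / (4 + \<gamma> * \<rho> / 4 * 0))"
        unfolding c_def using assms
        by (intro real_sqrt_unique) (simp_all add: power_mult_distrib, simp add: power2_eq_square field_simps)
      moreover have "(\<lambda>n. a (l n)) \<longlonglongrightarrow> 2 * (2 / \<gamma> + 0 * \<rho> / 4) * sqrt (2 * (\<gamma> * \<rho> / 4) / (4 + \<gamma> * \<rho> / 4 * 0))"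
        unfolding a_def by (intro tendsto_intros l) simp_all
      ultimately show "(\<lambda>n. a (l n)) \<longlonglongrightarrow> c" by simp
      have "(\<lambda>n. k (l n)) \<longlonglongrightarrow> 2 / \<gamma> + 0 * \<rho> / 4"
        unfolding k_def by (intro tendsto_intros l) simp_all
      then show "(\<lambda>n. k (l n)) \<longlonglongrightarrow> \<kappa>" by (simp add: \<kappa>_def)
      have "(\<lambda>n. r (l n)) \<longlonglongrightarrow> \<gamma> * \<rho> / 4 * 0 / (4 + \<gamma> * \<rho> / 4 * 0)"
        unfolding r_def by (intro tendsto_intros l) simp_all
      then show "(\<lambda>n. r (l n)) \<longlonglongrightarrow> 0" by simp
    qed (rule k_ge r_ge \<kappa> l)+
  qed simp
  have "((\<lambda>l. sqrt (2 * (LINT x|lborel. (h l x)\<^sup>2))) \<longlongrightarrow> sqrt (2 * 0)) (at_right 0)"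
    by (intro tendsto_intros lim_h)
  then have "((\<lambda>l. sqrt (2 * (LINT x|lborel. (h l x)\<^sup>2))) \<longlongrightarrow> 0) (at_right 0)" by simp
  then show "((\<lambda>l. Q_norm (\<lambda>x. phi_odd \<gamma> l \<rho> x - ?E x)) \<longlongrightarrow> 0) (at_right 0)"
  proof (rule tendsto_sandwich[OF _ _ tendsto_const, rotated 2])
    show "\<forall>\<^sub>F l in at_right 0. 0 \<le> Q_norm (\<lambda>x. phi_odd \<gamma> l \<rho> x - ?E x)"
      by (simp add: Q_norm_nonneg)
    show "\<forall>\<^sub>F l in at_right 0. Q_norm (\<lambda>x. phi_odd \<gamma> l \<rho> x - ?E x) \<le> sqrt (2 * (LINT x|lborel. (h l x)\<^sup>2))"
      using eventually_at_right_less[of 0]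
      by eventually_elim (intro Q_norm_le_if_H1_dominated dom int_h)
  qed
qed

theorem theorem3p9:
  fixes \<gamma> \<rho> :: real
  assumes "\<gamma> > 0" and "\<rho> > 0"
  shows "limitin Q_weak_topology (\<lambda>l. phi_even l \<rho>) (\<lambda>x. 0) (at_right 0)
       \<and> (\<forall>s. limitin Q_weak_topology (\<lambda>l. phi_asym s \<gamma> l \<rho>) (\<lambda>x. 0) (at_right 0))
       \<and> limitin Q_strong_topology (\<lambda>l. phi_odd \<gamma> l \<rho>)
           (\<lambda>x. of_real (sgn x * sqrt (2 * \<rho> / \<gamma>) * exp (- (2 / \<gamma>) * \<bar>x\<bar>))) (at_right 0)"
proof (intro conjI allI)
  show "limitin Q_weak_topology (\<lambda>l. phi_even l \<rho>) (\<lambda>x. 0) (at_right 0)"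
  proof (rule limitin_Q_weak_two_solitons[of _ "\<rho> / 4" \<rho>])
    fix l :: real assume l: "0 < l"
    let ?\<omega> = "(l * \<rho> / 4)\<^sup>2"
    have "sqrt ?\<omega> = l * \<rho> / 4" "0 < ?\<omega>" using l assms by simp_all
    then show "\<exists>k p q. phi_even l \<rho> = two_solitons 1 (sqrt (2 / l) * k) k p q \<and> 0 < k \<and> k \<le> \<rho> / 4 * l
      \<and> L2_norm_sq UNIV (phi_even l \<rho>) = \<rho>"
      using l assms phi_even_eq[OF l assms(2)] mass_psi_even[OF l, of ?\<omega>] psi_eq_two_solitons(1)[of l ?\<omega>]
      by (intro exI[of _ "sqrt ?\<omega>"] exI[of _ 0]) simp
  qed
  show "limitin Q_weak_topology (\<lambda>l. phi_asym s \<gamma> l \<rho>) (\<lambda>x. 0) (at_right 0)" for s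
  proof (rule limitin_Q_weak_two_solitons[of _ "\<rho> / 4" \<rho>])
    fix l :: real assume l: "0 < l"
    obtain \<omega> where \<omega>: "0 < \<omega>" "sqrt \<omega> \<le> \<rho> / 4 * l" "phi_asym s \<gamma> l \<rho> = psi_asym s \<gamma> l \<omega>"
      "L2_norm_sq UNIV (psi_asym s \<gamma> l \<omega>) = \<rho>"
      using phi_asym_eq[OF assms(1) l assms(2)] .
    then show "\<exists>k p q. phi_asym s \<gamma> l \<rho> = two_solitons 1 (sqrt (2 / l) * k) k p q \<and> 0 < k \<and> k \<le> \<rho> / 4 * l
      \<and> L2_norm_sq UNIV (phi_asym s \<gamma> l \<rho>) = \<rho>"
      by (intro exI[of _ "sqrt \<omega>"] exI[of _ "x1 s \<gamma> \<omega>"] exI[of _ "x2 s \<gamma> \<omega>"])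
        (simp add: psi_eq_two_solitons(2))
  qed
qed (rule limitin_phi_odd[OF assms])

end
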